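(* Let $d\ge 3$ be an integer. For every connected finite simple graph $G$ on at least $3$ vertices with maximum degree at most $d$, $$\min_{\lambda\in \sigma(\mathbf{A})}|\lambda|\le \sqrt{d-1},$$ with equality if and only if $G$ is the incidence graph of a finite projective plane of order $d-1$. Furthermore, if such a graph $G$ (connected, maximum degree at most $d$) is not the incidence graph of a finite projective plane, then $$\min_{\lambda\in \sigma(\mathbf{A})}|\lambda|\le \sqrt{d-2}.$$
   Context: $\mathbf{A}=\mathbf{A}(G)$ is the adjacency matrix of $G$ and $\sigma(\mathbf{A})$ its spectrum. A finite projective plane of order $n\ge 2$ is an incidence structure consisting of a finite set $P$ of points, a finite set $\mathcal{L}$ of lines and an incidence relation such that: every two distinct points are incident with a unique common line; every two distinct lines are incident with a unique common point; there exist four points no three of which are collinear; and some line is incident with exactly $n+1$ points. Its incidence graph is the bipartite graph with vertex set $P\sqcup\mathcal{L}$ in which $p\in P$ and $\ell\in\mathcal{L}$ are adjacent iff $p$ is incident with $\ell$. *)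

theory Defs
  imports "HOL-Analysis.Analysis"
begin

text \<open>A finite graph is given by its adjacency relation on a finite vertex type.\<close>

definition simple_graph :: "('v \<Rightarrow> 'v \<Rightarrow> bool) \<Rightarrow> bool" where
  "simple_graph E \<longleftrightarrow> symp E \<and> irreflp E"

definition connected_graph :: "('v \<Rightarrow> 'v \<Rightarrow> bool) \<Rightarrow> bool" where
  "connected_graph E \<longleftrightarrow> (\<forall>u v. E\<^sup>*\<^sup>* u v)"

definition vertex_degree :: "('v \<Rightarrow> 'v \<Rightarrow> bool) \<Rightarrow> 'v \<Rightarrow> nat" where
  "vertex_degree E v = card {u. E v u}"

definition max_degree :: "('v::finite \<Rightarrow> 'v \<Rightarrow> bool) \<Rightarrow> nat" where
  "max_degree E = Max (range (vertex_degree E))"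

definition adjacency_matrix :: "('v::finite \<Rightarrow> 'v \<Rightarrow> bool) \<Rightarrow> real ^ 'v ^ 'v" where
  "adjacency_matrix E = (\<chi> u v. if E u v then 1 else 0)"

text \<open>Only real eigenvalues are collected; for symmetric matrices, such as adjacency matrices
  of graphs, this is the whole spectrum.\<close>

definition matrix_spectrum :: "real ^ 'n ^ 'n \<Rightarrow> real set" where
  "matrix_spectrum A = {l. \<exists>x. x \<noteq> 0 \<and> A *v x = l *\<^sub>R x}"

definition projective_plane ::
  "nat \<Rightarrow> 'p set \<Rightarrow> 'l set \<Rightarrow> ('p \<Rightarrow> 'l \<Rightarrow> bool) \<Rightarrow> bool" where
  "projective_plane n P L I \<longleftrightarrow>
     n \<ge> 2 \<and> finite P \<and> finite L \<and>
     (\<forall>p\<in>P. \<forall>q\<in>P. p \<noteq> q \<longrightarrow> (\<exists>!l. l \<in> L \<and> I p l \<and> I q l)) \<and>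
     (\<forall>l\<in>L. \<forall>m\<in>L. l \<noteq> m \<longrightarrow> (\<exists>!p. p \<in> P \<and> I p l \<and> I p m)) \<and>
     (\<exists>Q\<subseteq>P. card Q = 4 \<and>
        (\<forall>R\<subseteq>Q. card R = 3 \<longrightarrow> \<not> (\<exists>l\<in>L. \<forall>p\<in>R. I p l))) \<and>
     (\<exists>l\<in>L. card {p \<in> P. I p l} = n + 1)"

text \<open>The vertex set of the incidence graph is the disjoint union \<open>P <+> L\<close>.\<close>

fun incidence_adj :: "('p \<Rightarrow> 'l \<Rightarrow> bool) \<Rightarrow> 'p + 'l \<Rightarrow> 'p + 'l \<Rightarrow> bool" where
  "incidence_adj I (Inl p) (Inr l) \<longleftrightarrow> I p l"
| "incidence_adj I (Inr l) (Inl p) \<longleftrightarrow> I p l"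
| "incidence_adj I (Inl p) (Inl q) \<longleftrightarrow> False"
| "incidence_adj I (Inr l) (Inr m) \<longleftrightarrow> False"

text \<open>``Is the incidence graph'' is meant up to graph isomorphism. Points and lines are drawn from
  the vertex type: this loses no generality, because any plane whose incidence graph is isomorphic
  to the given graph has at most as many points (and lines) as the graph has vertices, and so can
  be relabelled by vertices.\<close>

definition plane_incidence_graph :: "nat \<Rightarrow> ('v \<Rightarrow> 'v \<Rightarrow> bool) \<Rightarrow> bool" where
  "plane_incidence_graph n E \<longleftrightarrow>
     (\<exists>(P :: 'v set) (L :: 'v set) I f. projective_plane n P L I \<and>
        bij_betw f UNIV (P <+> L) \<and>
        (\<forall>u v. E u v \<longleftrightarrow> incidence_adj I (f u) (f v)))"

end

theory Submission
  imports Defs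
begin

text \<open>
  Suppose that all eigenvalues of \<open>A\<close> exceed \<open>sqrt (d - 2)\<close> in absolute
  value. Then the integer matrix \<open>M = A\<^sup>2 - (d - 2) I\<close> is positive definite. Its
  diagonal entries are at most 2, so all degrees are \<open>d - 1\<close> or \<open>d\<close> and
  two vertices have at most one common neighbour; read the vertices both as points and as lines of a
  partial linear space. Small minors and a count exclude the degree \<open>d - 1\<close>, so
  \<open>M = 2 I + B\<close>, where \<open>B\<close> is the adjacency matrix of the collinearity
  graph \<open>H\<close>, which is regular of degree \<open>d (d - 1)\<close> and has all
  eigenvalues greater than \<open>-2\<close>. Instead of classifying such graphs through root
  systems, one projects orthogonally to the roots of an induced claw or diamond of \<open>H\<close>
  (both span a \<open>D\<^sub>4\<close> lattice): the remaining neighbours become unit vectors with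
  inner products \<open>0\<close> or \<open>\<plusminus>1/2\<close>, and regularity provides too
  many of them, unless they all lie in one class of the dual lattice. Hence \<open>H\<close> has no
  claws, and a diamond, or a vertex of a diamond-free \<open>H\<close> whose neighbourhood is not a
  clique, leads to a point whose neighbourhood splits into two cliques; as every point is on
  \<open>d \<ge> 3\<close> lines, two of these lines lie in the same clique, which is impossible.

  So the components of \<open>H\<close> are complete. If there are two, the graph is the incidence
  graph of a projective plane of order \<open>d - 1\<close>; if there is only one, any two vertices
  have exactly one common neighbour, and an integrality argument as in the friendship theorem gives
  \<open>d = 2\<close>.
\<close>

section \<open>Positive definite kernels\<close>

text \<open>Symmetry is required on the whole type and only positivity on \<open>X\<close>, so
  rewriting with symmetry never needs membership in \<open>X\<close>.\<close>

definition pd_on :: "'v set \<Rightarrow> ('v \<Rightarrow> 'v \<Rightarrow> real) \<Rightarrow> bool" where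
  "pd_on X G \<longleftrightarrow> finite X \<and> (\<forall>u v. G u v = G v u) \<and>
     (\<forall>f. (\<exists>i\<in>X. f i \<noteq> 0) \<longrightarrow> 0 < (\<Sum>i\<in>X. \<Sum>j\<in>X. f i * f j * G i j))"

text \<open>If \<open>G\<close> is the Gram kernel of some vectors, this is the Gram kernel of their
  projections orthogonal to the vector of \<open>s\<close>. Nesting it projects away the span of
  several vectors, one at a time.\<close>

definition schur :: "('v \<Rightarrow> 'v \<Rightarrow> real) \<Rightarrow> 'v \<Rightarrow> 'v \<Rightarrow> 'v \<Rightarrow> real" where
  "schur G s u v = G u v - G u s * G s v / G s s"

lemma pd_on_sym: "pd_on X G \<Longrightarrow> G u v = G v u"
  by (simp add: pd_on_def)

lemma pd_on_pos:
  "pd_on X G \<Longrightarrow> i \<in> X \<Longrightarrow> f i \<noteq> 0 \<Longrightarrow> 0 < (\<Sum>i\<in>X. \<Sum>j\<in>X. f i * f j * G i j)"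
  by (auto simp: pd_on_def)

lemma pd_on_diag:
  assumes "pd_on X G" "u \<in> X"
  shows "0 < G u u"
proof -
  let ?f = "\<lambda>i. if i = u then 1 else 0 :: real"
  have fin: "finite X" using assms by (simp add: pd_on_def)
  have "0 < (\<Sum>i\<in>X. \<Sum>j\<in>X. ?f i * ?f j * G i j)"
    by (rule pd_on_pos[OF assms]) simp
  also have "\<dots> = (\<Sum>i\<in>X. if i = u then (\<Sum>j\<in>X. if j = u then G i j else 0) else 0)"
    by (intro sum.cong refl) (auto intro!: sum.cong sum.neutral)
  also have "\<dots> = G u u" using fin assms(2) by simp
  finally show ?thesis .
qed

lemma pd_on_schur:
  assumes pd: "pd_on X G" and s: "s \<in> X"
  shows "pd_on (X - {s}) (schur G s)"
proof -
  have fin: "finite X" and sym: "\<And>u v. G u v = G v u" using pd by (auto simp: pd_on_def)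
  have pos: "0 < G s s" by (rule pd_on_diag[OF pd s])
  let ?Y = "X - {s}"
  have "0 < (\<Sum>i\<in>?Y. \<Sum>j\<in>?Y. f i * f j * schur G s i j)" if nz: "\<exists>i\<in>?Y. f i \<noteq> 0" for f
  proof -
    define S where "S = (\<Sum>j\<in>?Y. f j * G j s)"
    \<comment> \<open>This value at \<open>s\<close> minimises the form for \<open>G\<close> while
      the other coordinates are those of \<open>f\<close>; completing the square leaves the form for
      \<open>schur G s\<close>.\<close>
    define t where "t = - S / G s s"
    define g where "g = f(s := t)"
    obtain k where k: "k \<in> ?Y" "f k \<noteq> 0" using nz by blast
    have "0 < (\<Sum>i\<in>X. \<Sum>j\<in>X. g i * g j * G i j)"
      by (rule pd_on_pos[OF pd, of k]) (use k in \<open>auto simp: g_def\<close>)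
    also have "\<dots> = (\<Sum>j\<in>X. g s * g j * G s j) + (\<Sum>i\<in>?Y. \<Sum>j\<in>X. g i * g j * G i j)"
      using fin s by (subst sum.remove[of X s]) auto
    also have "(\<Sum>j\<in>X. g s * g j * G s j) = g s * g s * G s s + (\<Sum>j\<in>?Y. g s * g j * G s j)"
      using fin s by (subst sum.remove[of X s]) auto
    also have "(\<Sum>j\<in>?Y. g s * g j * G s j) = t * S"
      unfolding S_def sum_distrib_left g_def by (intro sum.cong) (auto simp: sym)
    also have "(\<Sum>i\<in>?Y. \<Sum>j\<in>X. g i * g j * G i j)
        = (\<Sum>i\<in>?Y. f i * t * G i s + (\<Sum>j\<in>?Y. f i * f j * G i j))"
      using fin s by (intro sum.cong refl, subst sum.remove[of X s])
        (auto simp: g_def intro!: sum.cong)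
    also have "\<dots> = t * S + (\<Sum>i\<in>?Y. \<Sum>j\<in>?Y. f i * f j * G i j)"
      unfolding sum.distrib S_def sum_distrib_left by (simp add: mult.assoc mult.left_commute)
    finally have 1: "0 < t * t * G s s + 2 * t * S + (\<Sum>i\<in>?Y. \<Sum>j\<in>?Y. f i * f j * G i j)"
      by (simp add: g_def algebra_simps)
    have 2: "t * t * G s s + 2 * t * S = - (S * S / G s s)"
      using pos by (simp add: t_def field_simps)
    have "(\<Sum>i\<in>?Y. \<Sum>j\<in>?Y. f i * f j * schur G s i j)
       = (\<Sum>i\<in>?Y. \<Sum>j\<in>?Y. f i * f j * G i j - (f i * G i s) * (f j * G j s) / G s s)"
      unfolding schur_def by (intro sum.cong refl) (simp add: algebra_simps sym)
    also have "\<dots> = (\<Sum>i\<in>?Y. \<Sum>j\<in>?Y. f i * f j * G i j) - S * S / G s s"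
      unfolding sum_subtractf S_def sum_product sum_divide_distrib by simp
    finally show ?thesis using 1 2 by linarith
  qed
  moreover have "schur G s u v = schur G s v u" for u v
    unfolding schur_def by (simp add: sym mult.commute)
  ultimately show ?thesis using fin unfolding pd_on_def by blast
qed

text \<open>The strict Cauchy-Schwarz inequality: the projection of \<open>v\<close> orthogonal to
  \<open>u\<close> has positive squared norm. Most configurations below are excluded by violating it
  after some projections.\<close>

lemma pd_on_minor:
  assumes pd: "pd_on X G" and "u \<in> X" "v \<in> X" "u \<noteq> v"
  shows "(G u v)\<^sup>2 < G u u * G v v"
proof -
  have "0 < schur G u v v" using pd_on_diag[OF pd_on_schur[OF pd \<open>u \<in> X\<close>], of v] assms by auto
  moreover have "0 < G u u" using pd_on_diag[OF pd] assms by auto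
  ultimately show ?thesis
    by (simp add: schur_def pd_on_sym[OF pd, of v u] power2_eq_square field_simps)
qed

text \<open>Projecting orthogonally to a \<open>D\<^sub>4\<close> root lattice, roots become unit vectors that are orthogonal
  within a class of the dual lattice and have inner product \<open>\<plusminus>1/2\<close> between classes.\<close>

lemma abs_half_cases:
  fixes a :: real
  assumes "\<bar>a\<bar> = 1/2"
  obtains "a = 1/2" | "a = -(1/2)"
  using assms by linarith

lemma abs_half_square: "\<bar>a\<bar> = 1/2 \<Longrightarrow> a * a = 1/4" for a :: real
  by (elim abs_half_cases; hypsubst; simp)

text \<open>Otherwise the product of the three inner products would be negative, and with suitable
  signs the three unit vectors would add up to 0.\<close>

lemma pd_on_half_triple:
  assumes pd: "pd_on X G" and X: "x \<in> X" "u \<in> X" "w \<in> X" "x \<noteq> u" "x \<noteq> w" "u \<noteq> w"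
    and d: "G x x = 1" "G u u = 1" "G w w = 1"
    and h: "\<bar>G x u\<bar> = 1/2" "\<bar>G x w\<bar> = 1/2" "\<bar>G u w\<bar> = 1/2"
  shows "G u w = 2 * G x u * G x w"
proof -
  have ar: "c = 2 * a * b" if "(c - a * b)\<^sup>2 < (1 - a * a) * (1 - b * b)" "\<bar>a\<bar> = 1/2" "\<bar>b\<bar> = 1/2" "\<bar>c\<bar> = 1/2"
    for a b c :: real
    using that by (elim abs_half_cases; hypsubst; simp add: power2_eq_square)
  have "(schur G x u w)\<^sup>2 < schur G x u u * schur G x w w"
    by (rule pd_on_minor[OF pd_on_schur[OF pd X(1)]]) (use X in auto)
  then have "(G u w - G x u * G x w)\<^sup>2 < (1 - G x u * G x u) * (1 - G x w * G x w)"
    unfolding schur_def d pd_on_sym[OF pd, of u x] pd_on_sym[OF pd, of w x] by simp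
  then show ?thesis using h by (rule ar)
qed

text \<open>By \<open>pd_on_half_triple\<close>, signs can be chosen relative to \<open>w\<close> so
  that all mixed products are 1/2. Then \<open>x + y\<close> and \<open>u + v\<close> have squared
  norm 2 and inner product 2, so they coincide, against independence.\<close>

lemma pd_on_half_2_2_1:
  assumes pd: "pd_on X G"
    and X: "{x, y, u, v, w} \<subseteq> X" "distinct [x, y, u, v, w]"
    and d: "G x x = 1" "G y y = 1" "G u u = 1" "G v v = 1" "G w w = 1"
    and z: "G x y = 0" "G u v = 0"
    and h: "\<bar>G x u\<bar> = 1/2" "\<bar>G x v\<bar> = 1/2" "\<bar>G y u\<bar> = 1/2" "\<bar>G y v\<bar> = 1/2"
      "\<bar>G w x\<bar> = 1/2" "\<bar>G w y\<bar> = 1/2" "\<bar>G w u\<bar> = 1/2" "\<bar>G w v\<bar> = 1/2"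
  shows False
proof -
  have ar: False if "(2*a*c*(2*a*e) + 2*b*c*(2*b*e))\<^sup>2
        < (1 - 2*a*c*(2*a*c) - 2*b*c*(2*b*c)) * (1 - 2*a*e*(2*a*e) - 2*b*e*(2*b*e))"
      "\<bar>a\<bar> = 1/2" "\<bar>b\<bar> = 1/2" "\<bar>c\<bar> = 1/2" "\<bar>e\<bar> = 1/2"
    for a b c e :: real
    using that by (elim abs_half_cases; hypsubst; simp add: power2_eq_square)
  have mem: "x \<in> X" "y \<in> X" "u \<in> X" "v \<in> X" "w \<in> X" using X by auto
  have neq: "w \<noteq> x" "w \<noteq> y" "w \<noteq> u" "w \<noteq> v" "x \<noteq> u" "x \<noteq> v" "y \<noteq> u" "y \<noteq> v" using X by auto
  have e: "G x u = 2 * G w x * G w u" "G x v = 2 * G w x * G w v"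
    "G y u = 2 * G w y * G w u" "G y v = 2 * G w y * G w v"
    by (rule pd_on_half_triple[OF pd]; rule mem neq d h)+
  have "pd_on (X - {x} - {y}) (schur (schur G x) y)"
    using X by (intro pd_on_schur pd) auto
  then have "(schur (schur G x) y u v)\<^sup>2 < schur (schur G x) y u u * schur (schur G x) y v v"
    by (rule pd_on_minor) (use X in auto)
  then have "(G x u * G x v + G y u * G y v)\<^sup>2
      < (1 - G x u * G x u - G y u * G y u) * (1 - G x v * G x v - G y v * G y v)"
    unfolding schur_def d pd_on_sym[OF pd, of y x] pd_on_sym[OF pd, of u x] pd_on_sym[OF pd, of v x]
      pd_on_sym[OF pd, of u y] pd_on_sym[OF pd, of v y] z
    by (simp add: power2_eq_square algebra_simps)
  then show False unfolding e using h(5-8) by (rule ar)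
qed

text \<open>Equality in Bessel's inequality: four squares 1/4 add up to 1, so \<open>w\<close> would
  lie in the span of the other four.\<close>

lemma pd_on_half_4_1:
  assumes pd: "pd_on X G"
    and X: "{x, y, u, v, w} \<subseteq> X" "distinct [x, y, u, v, w]"
    and d: "G x x = 1" "G y y = 1" "G u u = 1" "G v v = 1" "G w w = 1"
    and z: "G x y = 0" "G x u = 0" "G x v = 0" "G y u = 0" "G y v = 0" "G u v = 0"
    and h: "\<bar>G x w\<bar> = 1/2" "\<bar>G y w\<bar> = 1/2" "\<bar>G u w\<bar> = 1/2" "\<bar>G v w\<bar> = 1/2"
  shows False
proof -
  have "pd_on (X - {x} - {y} - {u} - {v}) (schur (schur (schur (schur G x) y) u) v)"
    using X by (intro pd_on_schur pd) auto
  then have "0 < schur (schur (schur (schur G x) y) u) v w w"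
    by (rule pd_on_diag) (use X in auto)
  then have "0 < 1 - G x w * G x w - G y w * G y w - G u w * G u w - G v w * G v w"
    unfolding schur_def d pd_on_sym[OF pd, of y x] pd_on_sym[OF pd, of u x] pd_on_sym[OF pd, of v x]
      pd_on_sym[OF pd, of w x] pd_on_sym[OF pd, of u y] pd_on_sym[OF pd, of v y]
      pd_on_sym[OF pd, of w y] pd_on_sym[OF pd, of v u] pd_on_sym[OF pd, of w u]
      pd_on_sym[OF pd, of w v] z
    by simp
  then show False unfolding h[THEN abs_half_square] by simp
qed

text \<open>Projected orthogonally to the three vectors, \<open>v\<close> and \<open>w\<close> keep
  squared norm 1/4, while their inner product becomes an odd multiple of 1/4, too large for strict
  Cauchy-Schwarz.\<close>

lemma pd_on_half_3_2:
  assumes pd: "pd_on X G"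
    and X: "{x, y, u, v, w} \<subseteq> X" "distinct [x, y, u, v, w]"
    and d: "G x x = 1" "G y y = 1" "G u u = 1" "G v v = 1" "G w w = 1"
    and z: "G x y = 0" "G x u = 0" "G y u = 0"
    and h: "\<bar>G x v\<bar> = 1/2" "\<bar>G y v\<bar> = 1/2" "\<bar>G u v\<bar> = 1/2"
      "\<bar>G x w\<bar> = 1/2" "\<bar>G y w\<bar> = 1/2" "\<bar>G u w\<bar> = 1/2"
    and vw: "G v w = 0 \<or> \<bar>G v w\<bar> = 1/2"
  shows False
proof -
  have pr: "\<bar>a * b\<bar> = 1/2 * (1/2)" if "\<bar>a\<bar> = 1/2" "\<bar>b\<bar> = 1/2" for a b :: real
    using that by (simp only: abs_mult)
  have ar: False if "(t - a - b - c)\<^sup>2 < 1/16" "\<bar>a\<bar> = 1/2 * (1/2)" "\<bar>b\<bar> = 1/2 * (1/2)" "\<bar>c\<bar> = 1/2 * (1/2)"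
    "t = 0 \<or> \<bar>t\<bar> = 1/2" for a b c t :: real
  proof -
    have "\<bar>t - a - b - c\<bar> < 1/4"
      by (rule power_less_imp_less_base[of _ 2]) (use that(1) in \<open>simp_all add: power_divide\<close>)
    moreover have "a = 1/4 \<or> a = -(1/4)" "b = 1/4 \<or> b = -(1/4)" "c = 1/4 \<or> c = -(1/4)"
      "t = 0 \<or> t = 1/2 \<or> t = -(1/2)"
      using that(2-5) by linarith+
    ultimately show False by (elim disjE; hypsubst; simp)
  qed
  have "pd_on (X - {x} - {y} - {u}) (schur (schur (schur G x) y) u)"
    using X by (intro pd_on_schur pd) auto
  then have "(schur (schur (schur G x) y) u v w)\<^sup>2
      < schur (schur (schur G x) y) u v v * schur (schur (schur G x) y) u w w"
    by (rule pd_on_minor) (use X in auto)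
  then have "(G v w - G x v * G x w - G y v * G y w - G u v * G u w)\<^sup>2
      < (1 - G x v * G x v - G y v * G y v - G u v * G u v)
        * (1 - G x w * G x w - G y w * G y w - G u w * G u w)"
    unfolding schur_def d pd_on_sym[OF pd, of y x] pd_on_sym[OF pd, of u x] pd_on_sym[OF pd, of v x]
      pd_on_sym[OF pd, of w x] pd_on_sym[OF pd, of u y] pd_on_sym[OF pd, of v y]
      pd_on_sym[OF pd, of w y] pd_on_sym[OF pd, of v u] pd_on_sym[OF pd, of w u] z
    by simp
  then have "(G v w - G x v * G x w - G y v * G y w - G u v * G u w)\<^sup>2 < 1/16"
    unfolding h[THEN abs_half_square] by simp
  then show False
    using pr[OF h(1,4)] pr[OF h(2,5)] pr[OF h(3,6)] vw by (rule ar)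
qed

lemma card_ge_2_obtain:
  assumes "2 \<le> card S"
  obtains x y where "x \<in> S" "y \<in> S" "x \<noteq> y"
  using assms by (auto simp: card_le_Suc_iff numeral_eq_Suc)

lemma card_ge_3_obtain:
  assumes "3 \<le> card S"
  obtains x y z where "x \<in> S" "y \<in> S" "z \<in> S" "distinct [x, y, z]"
  using assms by (auto simp: card_le_Suc_iff numeral_eq_Suc)

lemma card_ge_4_obtain:
  assumes "4 \<le> card S"
  obtains x y z t where "x \<in> S" "y \<in> S" "z \<in> S" "t \<in> S" "distinct [x, y, z, t]"
  using assms by (auto simp: card_le_Suc_iff numeral_eq_Suc)

text \<open>A count of class sizes. A class of size at least 3 leaves at most one vector outside, so
  it has at least 4 members and then nothing else fits. If all sizes were at most 2, a total of 5
  would force two pairs and a third non-empty class.\<close>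

lemma pd_on_half_single_class:
  fixes cls :: "'v \<Rightarrow> nat"
  assumes pd: "pd_on Y G" and XY: "X \<subseteq> Y" and card: "5 \<le> card X"
    and cls: "\<And>v. v \<in> X \<Longrightarrow> cls v < 3"
    and diag: "\<And>v. v \<in> X \<Longrightarrow> G v v = 1"
    and same: "\<And>v w. v \<in> X \<Longrightarrow> w \<in> X \<Longrightarrow> v \<noteq> w \<Longrightarrow> cls v = cls w \<Longrightarrow> G v w = 0"
    and diff: "\<And>v w. v \<in> X \<Longrightarrow> w \<in> X \<Longrightarrow> cls v \<noteq> cls w \<Longrightarrow> \<bar>G v w\<bar> = 1/2"
    and uv: "u \<in> X" "v \<in> X"
  shows "cls u = cls v"
proof -
  have finX: "finite X" using pd XY finite_subset by (auto simp: pd_on_def)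
  define S where "S i = {v \<in> X. cls v = i}" for i
  define c where "c i = card (S i)" for i
  have finS: "finite (S i)" for i using finX by (simp add: S_def)
  have X: "X = S 0 \<union> S 1 \<union> S 2" using cls by (force simp: S_def)
  have tot: "5 \<le> c 0 + c 1 + c 2"
    using card card_Un_le[of "S 0 \<union> S 1" "S 2"] card_Un_le[of "S 0" "S 1"] unfolding X c_def by linarith
  have four: "S j = {}" if le: "4 \<le> c i" and ij: "i \<noteq> j" for i j
  proof (rule ccontr)
    assume "S j \<noteq> {}"
    then obtain w where w: "w \<in> S j" by auto
    obtain x y z t where "x \<in> S i" "y \<in> S i" "z \<in> S i" "t \<in> S i" "distinct [x, y, z, t]"
      using card_ge_4_obtain[OF le[unfolded c_def]] by blast
    then show False using w ij XY
      by (intro pd_on_half_4_1[OF pd, of x y z t w] diag same diff) (auto simp: S_def)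
  qed
  have three: False if le: "3 \<le> c i" and vw: "v \<in> X" "w \<in> X" "v \<noteq> w" "v \<notin> S i" "w \<notin> S i" for i v w
  proof -
    obtain x y z where *: "x \<in> S i" "y \<in> S i" "z \<in> S i" "distinct [x, y, z]"
      using card_ge_3_obtain[OF le[unfolded c_def]] by blast
    have "G v w = 0 \<or> \<bar>G v w\<bar> = 1/2" using same[of v w] diff[of v w] vw by blast
    then show False using * vw XY
      by (intro pd_on_half_3_2[OF pd, of x y z v w] diag same diff) (auto simp: S_def)
  qed
  have two: "S k = {}" if le: "2 \<le> c i" "2 \<le> c j" and ijk: "i \<noteq> j" "i \<noteq> k" "j \<noteq> k" for i j k
  proof (rule ccontr)
    assume "S k \<noteq> {}"
    then obtain w where w: "w \<in> S k" by auto
    obtain x y where "x \<in> S i" "y \<in> S i" "x \<noteq> y"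
      using card_ge_2_obtain[OF le(1)[unfolded c_def]] by blast
    moreover obtain z t where "z \<in> S j" "t \<in> S j" "z \<noteq> t"
      using card_ge_2_obtain[OF le(2)[unfolded c_def]] by blast
    ultimately show False using w ijk XY
      by (intro pd_on_half_2_2_1[OF pd, of x y z t w] diag same diff) (auto simp: S_def)
  qed
  have three': "4 \<le> c i" if "3 \<le> c i" for i
  proof -
    have "card (X - S i) \<le> 1"
      using three[OF that] card_le_Suc0_iff_eq[of "X - S i"] finX by auto
    moreover have "card X = c i + card (X - S i)"
      using finX card_Un_disjoint[of "S i" "X - S i"] finS by (simp add: c_def Un_absorb1 S_def)
    ultimately show ?thesis using card by linarith
  qed
  have "\<exists>i. 4 \<le> c i"
  proof (rule ccontr)
    assume "\<not> ?thesis"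
    then have "c 0 \<le> 2" "c 1 \<le> 2" "c 2 \<le> 2" using three' by (metis not_less_eq_eq numeral_2_eq_2 numeral_3_eq_3)+
    moreover have "c i = 0 \<longleftrightarrow> S i = {}" for i by (simp add: c_def finS)
    ultimately show False using two[of 0 1 2] two[of 0 2 1] two[of 1 2 0] tot by force
  qed
  then obtain i where "4 \<le> c i" ..
  then have "cls w = i" if "w \<in> X" for w using four[of i "cls w"] that by (auto simp: S_def)
  then show ?thesis using uv by simp
qed

section \<open>Symmetric matrices\<close>

lemma symmetric_inner_mult:
  fixes A :: "real ^ 'n ^ 'n"
  assumes "transpose A = A"
  shows "(A *v x) \<bullet> y = x \<bullet> (A *v y)"
  by (metis assms dot_lmul_matrix transpose_matrix_vector)

text \<open>The first-order condition at a minimum: for small \<open>t\<close> of sign opposite to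
  \<open>b\<close>, the linear term outweighs the quadratic one.\<close>

lemma nonneg_linear_quadratic:
  fixes b C :: real
  assumes "\<And>t. 0 \<le> 2 * t * b + t\<^sup>2 * C"
  shows "b = 0"
proof (rule ccontr)
  assume b: "b \<noteq> 0"
  define k where "k = \<bar>C\<bar> + 1"
  have k: "k > 0" "C < 2 * k" by (auto simp: k_def)
  have "2 * (- b / k) * b + (- b / k)\<^sup>2 * C = b\<^sup>2 / k\<^sup>2 * (C - 2 * k)"
    using k by (simp add: field_simps power2_eq_square)
  also have "\<dots> < 0" using b k by (intro mult_pos_neg) auto
  finally show False using assms[of "- b / k"] by linarith
qed

text \<open>A minimiser \<open>x\<close> of \<open>|A x|\<close> on the unit sphere is an eigenvector of \<open>A\<^sup>2\<close>, for the eigenvalue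
  \<open>s\<^sup>2\<close> say; since \<open>(A - s) (A + s) x = 0\<close>, one of \<open>s\<close>, \<open>-s\<close> is an eigenvalue of \<open>A\<close>.\<close>

lemma symmetric_least_abs_eigenvalue:
  fixes A :: "real ^ 'n ^ 'n"
  assumes sym: "transpose A = A"
  obtains l where "l \<in> matrix_spectrum A" "\<And>x. l\<^sup>2 * (x \<bullet> x) \<le> (A *v x) \<bullet> (A *v x)"
proof -
  let ?q = "\<lambda>x. (A *v x) \<bullet> (A *v x)"
  have "axis undefined 1 \<in> sphere (0 :: real ^ 'n) 1" by (simp add: norm_axis_1)
  then have "\<exists>x\<in>sphere (0 :: real ^ 'n) 1. \<forall>y\<in>sphere 0 1. ?q x \<le> ?q y"
    by (intro continuous_attains_inf continuous_on_inner linear_continuous_on) auto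
  then obtain x0 where x0: "norm x0 = 1" "\<And>y. norm y = 1 \<Longrightarrow> ?q x0 \<le> ?q y" by auto
  define m where "m = ?q x0"
  have m0: "0 \<le> m" by (simp add: m_def)
  have le: "m * (x \<bullet> x) \<le> ?q x" for x
  proof (cases "x = 0")
    case False
    have "m \<le> ?q ((1 / norm x) *\<^sub>R x)" unfolding m_def using False by (intro x0) simp
    also have "\<dots> = ?q x / (norm x)\<^sup>2"
      by (simp add: matrix_vector_mult_scaleR power2_eq_square)
    finally show ?thesis using False by (simp add: field_simps power2_norm_eq_inner)
  qed simp
  \<comment> \<open>The defect in the eigenvector equation for the square of \<open>A\<close>.
    Moving the minimiser \<open>x0\<close> in the direction \<open>y\<close> changes the form to
    first order by \<open>2 * t * (y \<bullet> y)\<close>, so \<open>y\<close> must vanish.\<close>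
  define y where "y = A *v (A *v x0) - m *\<^sub>R x0"
  have "0 \<le> 2 * t * (y \<bullet> y) + t\<^sup>2 * (?q y - m * (y \<bullet> y))" for t
  proof -
    have "x0 \<bullet> x0 = 1" using x0(1) by (simp add: norm_eq_1)
    moreover have "y \<bullet> y = (A *v x0) \<bullet> (A *v y) - m * (x0 \<bullet> y)"
      by (subst (1) y_def) (simp add: inner_diff_left symmetric_inner_mult[OF sym])
    then have "(A *v x0) \<bullet> (A *v y) = y \<bullet> y + m * (x0 \<bullet> y)" by simp
    moreover have "m * ((x0 + t *\<^sub>R y) \<bullet> (x0 + t *\<^sub>R y)) \<le> ?q (x0 + t *\<^sub>R y)" by (rule le)
    ultimately show ?thesis
      by (simp add: matrix_vector_right_distrib matrix_vector_mult_scaleR inner_add_left inner_add_right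
        m_def[symmetric] inner_commute algebra_simps power2_eq_square)
  qed
  then have "y \<bullet> y = 0" by (rule nonneg_linear_quadratic)
  then have ev: "A *v (A *v x0) = m *\<^sub>R x0" by (simp add: y_def)
  define s where "s = sqrt m"
  have s2: "s\<^sup>2 = m" using m0 by (simp add: s_def)
  define z where "z = A *v x0 + s *\<^sub>R x0"
  show ?thesis
  proof (cases "z = 0")
    case True
    then have "A *v x0 = (- s) *\<^sub>R x0" by (simp add: z_def add_eq_0_iff2)
    then have "- s \<in> matrix_spectrum A" using x0(1) by (auto simp: matrix_spectrum_def intro!: exI[of _ x0])
    then show ?thesis using le s2 by (intro that[of "- s"]) auto
  next
    case False
    have "A *v z = s *\<^sub>R z"
      by (simp add: z_def matrix_vector_right_distrib matrix_vector_mult_scaleR ev s2[symmetric]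
        scaleR_add_right power2_eq_square)
    then have "s \<in> matrix_spectrum A" using False unfolding matrix_spectrum_def by blast
    then show ?thesis using le s2 by (intro that[of s]) auto
  qed
qed

text \<open>Eigenvectors for distinct eigenvalues are orthogonal, hence independent. Finiteness
  makes \<open>Min\<close> over the spectrum a genuine minimum.\<close>

lemma finite_symmetric_spectrum:
  fixes A :: "real ^ 'n ^ 'n"
  assumes sym: "transpose A = A"
  shows "finite (matrix_spectrum A)"
proof -
  define e where "e l = (SOME x. x \<noteq> 0 \<and> A *v x = l *\<^sub>R x)" for l
  have e: "e l \<noteq> 0" "A *v e l = l *\<^sub>R e l" if "l \<in> matrix_spectrum A" for l
    using that someI_ex[of "\<lambda>x. x \<noteq> 0 \<and> A *v x = l *\<^sub>R x"] by (auto simp: e_def matrix_spectrum_def)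
  have orth: "e l \<bullet> e k = 0" if "l \<in> matrix_spectrum A" "k \<in> matrix_spectrum A" "l \<noteq> k" for l k
    using symmetric_inner_mult[OF sym, of "e l" "e k"] e that by simp
  have inj: "inj_on e (matrix_spectrum A)"
    by (rule inj_onI) (metis orth e(1) inner_eq_zero_iff)
  have "pairwise orthogonal (e ` matrix_spectrum A)"
    unfolding pairwise_def orthogonal_def using orth by auto
  then have "independent (e ` matrix_spectrum A)"
    by (rule pairwise_orthogonal_independent) (use e in auto)
  then have "finite (e ` matrix_spectrum A)" by (rule finiteI_independent)
  then show ?thesis using finite_imageD inj by blast
qed

lemma Min_abs_spectrum_greater:
  fixes A :: "real ^ 'n ^ 'n"
  assumes sym: "transpose A = A" and c: "0 \<le> c" "c < Min (abs ` matrix_spectrum A)" and x: "x \<noteq> 0"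
  shows "c\<^sup>2 * (x \<bullet> x) < (A *v x) \<bullet> (A *v x)"
proof -
  obtain l where l: "l \<in> matrix_spectrum A" "\<And>x. l\<^sup>2 * (x \<bullet> x) \<le> (A *v x) \<bullet> (A *v x)"
    using symmetric_least_abs_eigenvalue[OF sym] by blast
  have "Min (abs ` matrix_spectrum A) \<le> \<bar>l\<bar>"
    using l(1) finite_symmetric_spectrum[OF sym] by (intro Min_le) auto
  then have "c < \<bar>l\<bar>" using c by linarith
  then have "c\<^sup>2 < l\<^sup>2" using c(1) power_strict_mono[of c "\<bar>l\<bar>" 2] by simp
  then have "c\<^sup>2 * (x \<bullet> x) < l\<^sup>2 * (x \<bullet> x)" using x by (intro mult_strict_right_mono) auto
  then show ?thesis using l(2)[of x] by linarith
qed

lemma Min_abs_spectrum_ge: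
  fixes A :: "real ^ 'n ^ 'n"
  assumes sym: "transpose A = A" and c: "\<And>x. c\<^sup>2 * (x \<bullet> x) \<le> (A *v x) \<bullet> (A *v x)"
  shows "c \<le> Min (abs ` matrix_spectrum A)"
proof -
  obtain l where "l \<in> matrix_spectrum A"
    using symmetric_least_abs_eigenvalue[OF sym] by blast
  then have "Min (abs ` matrix_spectrum A) \<in> abs ` matrix_spectrum A"
    using finite_symmetric_spectrum[OF sym] by (intro Min_in) auto
  then obtain k where k: "k \<in> matrix_spectrum A" "Min (abs ` matrix_spectrum A) = \<bar>k\<bar>" by auto
  then obtain x where x: "x \<noteq> 0" "A *v x = k *\<^sub>R x" by (auto simp: matrix_spectrum_def)
  have "c\<^sup>2 * (x \<bullet> x) \<le> k\<^sup>2 * (x \<bullet> x)" using c[of x] x(2) by (simp add: power2_eq_square mult.assoc)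
  then have "c\<^sup>2 \<le> k\<^sup>2" using x(1) by simp
  then show ?thesis using k(2) by (metis abs_ge_self abs_le_square_iff order_trans)
qed

text \<open>The trace of an orthogonal projection is its rank.\<close>

lemma trace_projection_nat:
  fixes T :: "real ^ 'n \<Rightarrow> real ^ 'n"
  assumes lin: "linear T" and idem: "\<And>x. T (T x) = T x" and sym: "\<And>x y. T x \<bullet> y = x \<bullet> T y"
  shows "\<exists>k::nat. (\<Sum>i\<in>UNIV. T (axis i 1) $ i) = real k"
proof -
  have "subspace (range T)" using lin by (simp add: linear_subspace_image)
  then obtain B where B: "B \<subseteq> range T" "pairwise orthogonal B" "\<And>x. x \<in> B \<Longrightarrow> norm x = 1"
      "independent B" "card B = dim (range T)" "span B = range T"
    using orthonormal_basis_subspace by blast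
  have finB: "finite B" using B(4) by (rule finiteI_independent)
  have T: "T x = (\<Sum>b\<in>B. (b \<bullet> x) *\<^sub>R b)" for x
  proof -
    have Tb: "T b = b" if "b \<in> B" for b using that B(1) idem by auto
    have "T x \<in> span B" using B(6) by simp
    then obtain u where u: "T x = (\<Sum>b\<in>B. u b *\<^sub>R b)" using span_finite[OF finB] by auto
    have "u b = b \<bullet> x" if b: "b \<in> B" for b
    proof -
      have "b \<bullet> x = b \<bullet> T x" using sym[of b x] Tb[OF b] by simp
      also have "\<dots> = (\<Sum>c\<in>B. u c * (b \<bullet> c))" by (simp add: u inner_sum_right)
      also have "\<dots> = (\<Sum>c\<in>B. if c = b then u b else 0)"
        using B(2,3) b by (intro sum.cong) (auto simp: pairwise_def orthogonal_def norm_eq_1)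
      also have "\<dots> = u b" using b finB by simp
      finally show ?thesis by simp
    qed
    then show ?thesis using u by (simp cong: sum.cong)
  qed
  have "(\<Sum>i\<in>UNIV. T (axis i 1) $ i) = (\<Sum>i\<in>UNIV. \<Sum>b\<in>B. b $ i * b $ i)"
    unfolding T by (simp add: inner_axis)
  also have "\<dots> = (\<Sum>b\<in>B. \<Sum>i\<in>UNIV. b $ i * b $ i)" by (rule sum.swap)
  also have "\<dots> = (\<Sum>b\<in>B. b \<bullet> b)" by (simp add: inner_vec_def)
  also have "\<dots> = (\<Sum>b\<in>B. 1)" using B(3) by (intro sum.cong) (auto simp: norm_eq_1)
  finally show ?thesis by simp
qed

section \<open>Projections orthogonal to a claw or a diamond\<close>

lemma schur_claw:
  assumes sym: "\<And>u v. G u v = G v u"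
    and diag: "G a a = 2" "G b b = 2" "G c c = 2" "G p p = 2"
    and off: "G a b = 0" "G a c = 0" "G b c = 0" "G p a = 1" "G p b = 1" "G p c = 1"
  shows "schur (schur (schur (schur G a) b) c) p v w =
    G v w - (G v a * G w a + G v b * G w b + G v c * G w c) / 2
      - 2 * (G v p - (G v a + G v b + G v c) / 2) * (G w p - (G w a + G w b + G w c) / 2)"
proof -
  have ab: "schur (schur G a) b v w = G v w - G v a * G w a / 2 - G v b * G w b / 2" for v w
    by (simp add: schur_def diag off sym[of b a] sym[of a w] sym[of b w])
  have abc: "schur (schur (schur G a) b) c v w
      = G v w - G v a * G w a / 2 - G v b * G w b / 2 - G v c * G w c / 2" for v w
    by (simp add: schur_def[of "schur (schur G a) b"] ab diag off sym[of c a] sym[of c b] sym[of c w])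
  \<comment> \<open>Once the three leaves are projected away, \<open>p\<close> has squared norm 2 -
    3/2 = 1/2; this is the source of the factor 2 in the last term.\<close>
  show ?thesis
    by (simp add: schur_def[of "schur (schur (schur G a) b) c"] abc diag off sym[of p w] field_simps)
qed

text \<open>Once \<open>a\<close> and \<open>b\<close> are projected away, \<open>p\<close> and
  \<open>z\<close> are orthonormal: their squared norms are 2 - 1 and their inner product is 1 - 1.
  Hence the last two terms need no denominators.\<close>

lemma schur_diamond:
  assumes sym: "\<And>u v. G u v = G v u"
    and diag: "G a a = 2" "G b b = 2" "G p p = 2" "G z z = 2"
    and off: "G a b = 0" "G p z = 1" "G p a = 1" "G p b = 1" "G z a = 1" "G z b = 1"
  shows "schur (schur (schur (schur G a) b) p) z v w =
    G v w - (G v a * G w a + G v b * G w b) / 2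
      - (G v p - (G v a + G v b) / 2) * (G w p - (G w a + G w b) / 2)
      - (G v z - (G v a + G v b) / 2) * (G w z - (G w a + G w b) / 2)"
proof -
  have ab: "schur (schur G a) b v w = G v w - G v a * G w a / 2 - G v b * G w b / 2" for v w
    by (simp add: schur_def diag off sym[of b a] sym[of a w] sym[of b w])
  have abp: "schur (schur (schur G a) b) p v w = G v w - G v a * G w a / 2 - G v b * G w b / 2
      - (G v p - (G v a + G v b) / 2) * (G w p - (G w a + G w b) / 2)" for v w
    by (simp add: schur_def[of "schur (schur G a) b"] ab diag off sym[of p w] field_simps)
  show ?thesis
    by (simp add: schur_def[of "schur (schur (schur G a) b) p"] abp diag off sym[of z p] sym[of z w] field_simps)
qed

section \<open>Regular graphs with least eigenvalue greater than -2\<close>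

text \<open>The matrix \<open>2 I + B\<close> for the adjacency matrix \<open>B\<close> of
  \<open>H\<close>. When it is positive definite, vertices can be read as linearly independent roots
  of squared norm 2.\<close>

definition collinearity_gram :: "('v \<Rightarrow> 'v \<Rightarrow> bool) \<Rightarrow> 'v \<Rightarrow> 'v \<Rightarrow> real" where
  "collinearity_gram H u v = (if u = v then 2 else if H u v then 1 else 0)"

locale pd_regular =
  fixes H :: "'v::finite \<Rightarrow> 'v \<Rightarrow> bool" and r :: nat
  assumes H_sym: "H u v \<Longrightarrow> H v u" and H_irrefl: "\<not> H u u"
    and H_regular: "card {v. H u v} = r" and r_ge: "6 \<le> r"
    and H_pd: "pd_on UNIV (collinearity_gram H)"
begin

abbreviation "K \<equiv> collinearity_gram H"

lemma H_commute: "H u v \<longleftrightarrow> H v u" using H_sym by blast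

lemma K_eqs: "K u u = 2" "H u v \<Longrightarrow> K u v = 1" "u \<noteq> v \<Longrightarrow> \<not> H u v \<Longrightarrow> K u v = 0"
  by (auto simp: collinearity_gram_def H_irrefl)

lemma K_cases: "u \<noteq> v \<Longrightarrow> K u v = 0 \<and> \<not> H u v \<or> K u v = 1 \<and> H u v"
  by (auto simp: collinearity_gram_def)

lemma K_sym: "K u v = K v u"
  by (rule pd_on_sym[OF H_pd])

text \<open>Adjacent vertices have the same degree and share their common neighbours, so equally
  many neighbours remain on either side. This is how regularity produces new vertices next to a
  configuration.\<close>

lemma card_nbr_diff:
  assumes "H a p"
  shows "card {v. H a v \<and> v \<noteq> p \<and> \<not> H v p} = card {v. H p v \<and> v \<noteq> a \<and> \<not> H v a}"
proof -
  have *: "r = Suc (card {v. H a v \<and> H p v}) + card {v. H a v \<and> v \<noteq> p \<and> \<not> H v p}" if "H a p" for a p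
  proof -
    have "{v. H a v} = insert p {v. H a v \<and> H p v} \<union> {v. H a v \<and> v \<noteq> p \<and> \<not> H v p}"
      using that H_commute by auto
    then have "r = card (insert p {v. H a v \<and> H p v} \<union> {v. H a v \<and> v \<noteq> p \<and> \<not> H v p})"
      using H_regular[of a] by simp
    also have "\<dots> = card (insert p {v. H a v \<and> H p v}) + card {v. H a v \<and> v \<noteq> p \<and> \<not> H v p}"
      using H_commute by (intro card_Un_disjoint) auto
    also have "card (insert p {v. H a v \<and> H p v}) = Suc (card {v. H a v \<and> H p v})"
      using H_irrefl by (intro card_insert_disjoint) auto
    finally show ?thesis .
  qed
  have "{v. H a v \<and> H p v} = {v. H p v \<and> H a v}" by auto
  then show ?thesis using *[OF assms] *[OF H_sym[OF assms]] by simp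
qed

text \<open>Otherwise the roots would satisfy \<open>a + b = p + q\<close>: after projecting away
  \<open>a\<close> and \<open>b\<close>, the vectors of \<open>p\<close> and \<open>q\<close> have
  squared norm 1 and inner product -1.\<close>

lemma no_induced_four_cycle:
  assumes "H a p" "H p b" "H b q" "H q a" "a \<noteq> b" "p \<noteq> q" "\<not> H a b"
  shows "H p q"
proof (rule ccontr)
  assume n: "\<not> H p q"
  note v = assms n H_sym[OF assms(1)] H_sym[OF assms(2)] H_sym[OF assms(3)] H_sym[OF assms(4)]
  have "pd_on (UNIV - {a} - {b}) (schur (schur K a) b)"
    using v by (intro pd_on_schur H_pd) auto
  then have "(schur (schur K a) b p q)\<^sup>2 < schur (schur K a) b p p * schur (schur K a) b q q"
    by (rule pd_on_minor) (use v H_irrefl in auto)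
  moreover have "K b a = 0" "K a b = 0" using v H_commute[of a b] by (auto simp: K_eqs)
  ultimately show False
    using v by (simp add: schur_def K_eqs)
qed

text \<open>Since \<open>p\<close> has the neighbours \<open>b\<close> and \<open>c\<close> not
  adjacent to \<open>a\<close>, \<open>card_nbr_diff\<close> gives two neighbours of
  \<open>a\<close> not adjacent to \<open>p\<close>. An edge from one of them to \<open>b\<close> or
  \<open>c\<close> would close an induced four-cycle.\<close>

lemma pendant_pair:
  assumes "H p a" "H p b" "H p c" "b \<noteq> c" "a \<noteq> b" "a \<noteq> c" "\<not> H a b" "\<not> H a c"
  obtains u v where "u \<noteq> v" "H a u" "H a v" "u \<noteq> p" "v \<noteq> p" "\<not> H u p" "\<not> H v p"
    "u \<noteq> b" "v \<noteq> b" "u \<noteq> c" "v \<noteq> c" "\<not> H u b" "\<not> H u c" "\<not> H v b" "\<not> H v c"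
proof -
  let ?S = "{v. H a v \<and> v \<noteq> p \<and> \<not> H v p}"
  have "{b, c} \<subseteq> {v. H p v \<and> v \<noteq> a \<and> \<not> H v a}" using assms H_commute by auto
  then have "card {b, c} \<le> card {v. H p v \<and> v \<noteq> a \<and> \<not> H v a}" by (intro card_mono) auto
  then have "2 \<le> card ?S" using card_nbr_diff[OF H_sym[OF assms(1)]] assms(4) by simp
  then obtain u v where uv: "u \<in> ?S" "v \<in> ?S" "u \<noteq> v"
    using card_le_Suc0_iff_eq[of ?S] by (auto simp: numeral_2_eq_2 not_less_eq_eq[symmetric])
  have "\<not> H w b \<and> \<not> H w c \<and> w \<noteq> b \<and> w \<noteq> c" if w: "w \<in> ?S" for w
    using no_induced_four_cycle[of a p b w] no_induced_four_cycle[of a p c w] w assms H_commute by blast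
  then show ?thesis using uv by (intro that[of u v]) auto
qed

text \<open>Each leaf of a claw has pendant neighbours. Two at \<open>a\<close>, two at
  \<open>b\<close> and one at \<open>c\<close>, projected orthogonally to the claw, form the
  configuration excluded by \<open>pd_on_half_2_2_1\<close>.\<close>

lemma claw_free:
  assumes H: "H p a" "H p b" "H p c" and neq: "a \<noteq> b" "a \<noteq> c" "b \<noteq> c"
    and n: "\<not> H a b" "\<not> H a c"
  shows "H b c"
proof (rule ccontr)
  assume nbc: "\<not> H b c"
  note n' = n nbc n[unfolded H_commute[of a]] nbc[unfolded H_commute[of b]]
  obtain a1 a2 where a: "a1 \<noteq> a2" "H a a1" "H a a2" "a1 \<noteq> p" "a2 \<noteq> p" "\<not> H a1 p" "\<not> H a2 p"
    "a1 \<noteq> b" "a2 \<noteq> b" "a1 \<noteq> c" "a2 \<noteq> c" "\<not> H a1 b" "\<not> H a1 c" "\<not> H a2 b" "\<not> H a2 c"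
    using pendant_pair[of p a b c] H neq n' by metis
  obtain b1 b2 where b: "b1 \<noteq> b2" "H b b1" "H b b2" "b1 \<noteq> p" "b2 \<noteq> p" "\<not> H b1 p" "\<not> H b2 p"
    "b1 \<noteq> a" "b2 \<noteq> a" "b1 \<noteq> c" "b2 \<noteq> c" "\<not> H b1 a" "\<not> H b1 c" "\<not> H b2 a" "\<not> H b2 c"
    using pendant_pair[of p b a c] H neq n' by metis
  obtain c1 where c: "H c c1" "c1 \<noteq> p" "\<not> H c1 p"
    "c1 \<noteq> a" "c1 \<noteq> b" "\<not> H c1 a" "\<not> H c1 b"
    using pendant_pair[of p c a b] H neq n' by metis
  let ?G = "schur (schur (schur (schur K a) b) c) p"
  have pd: "pd_on (UNIV - {a} - {b} - {c} - {p}) ?G"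
    using H neq H_irrefl by (intro pd_on_schur H_pd) auto
  have G: "?G v w = K v w - (K v a * K w a + K v b * K w b + K v c * K w c) / 2
      - 2 * (K v p - (K v a + K v b + K v c) / 2) * (K w p - (K w a + K w b + K w c) / 2)" for v w
    by (rule schur_claw, rule K_sym) (use H neq n' in \<open>auto simp: K_eqs\<close>)
  have ka: "K v a = 1 \<and> K v b = 0 \<and> K v c = 0 \<and> K v p = 0" if "v = a1 \<or> v = a2" for v
    using that a H_commute by (auto intro!: K_eqs)
  have kb: "K v a = 0 \<and> K v b = 1 \<and> K v c = 0 \<and> K v p = 0" if "v = b1 \<or> v = b2" for v
    using that b H_commute by (auto intro!: K_eqs)
  have kc: "K c1 a = 0 \<and> K c1 b = 0 \<and> K c1 c = 1 \<and> K c1 p = 0"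
    using c H_commute by (auto intro!: K_eqs)
  have ne: "a1 \<noteq> b1" "a1 \<noteq> b2" "a2 \<noteq> b1" "a2 \<noteq> b2" "a1 \<noteq> c1" "a2 \<noteq> c1" "b1 \<noteq> c1" "b2 \<noteq> c1"
    using a b c H_commute by auto
  have ne': "a1 \<noteq> a" "a2 \<noteq> a" "b1 \<noteq> b" "b2 \<noteq> b" "c1 \<noteq> c"
    using a b c H_irrefl by metis+
  \<comment> \<open>The projections of \<open>a1\<close> and \<open>a2\<close> are unit vectors with
    inner product \<open>K a1 a2 - 1\<close>. Non-adjacency would give -1, so the two are adjacent
    and their projections orthogonal.\<close>
  have aa: "K a1 a2 = 1"
    using pd_on_minor[OF pd, of a1 a2] a K_cases[of a1 a2] ne' unfolding G by (auto simp: ka K_eqs)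
  have bb: "K b1 b2 = 1"
    using pd_on_minor[OF pd, of b1 b2] b K_cases[of b1 b2] ne' unfolding G by (auto simp: kb K_eqs)
  have half: "\<bar>k - 1/2\<bar> = 1/2" if "k = 0 \<or> k = 1" for k :: real using that by auto
  have K01: "K v w = 0 \<or> K v w = 1" if "v \<noteq> w" for v w using K_cases[OF that] by blast
  have g: "?G a1 b1 = K a1 b1 - 1/2" "?G a1 b2 = K a1 b2 - 1/2"
    "?G a2 b1 = K a2 b1 - 1/2" "?G a2 b2 = K a2 b2 - 1/2"
    "?G c1 a1 = K c1 a1 - 1/2" "?G c1 a2 = K c1 a2 - 1/2"
    "?G c1 b1 = K c1 b1 - 1/2" "?G c1 b2 = K c1 b2 - 1/2"
    unfolding G by (simp_all add: ka kb kc)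
  show False
  proof (rule pd_on_half_2_2_1[OF pd, of a1 a2 b1 b2 c1])
    show "{a1, a2, b1, b2, c1} \<subseteq> UNIV - {a} - {b} - {c} - {p}"
      using a b c ne' by auto
    show "distinct [a1, a2, b1, b2, c1]" using ne a b by auto
    show "\<bar>?G a1 b1\<bar> = 1/2" "\<bar>?G a1 b2\<bar> = 1/2" "\<bar>?G a2 b1\<bar> = 1/2" "\<bar>?G a2 b2\<bar> = 1/2"
      "\<bar>?G c1 a1\<bar> = 1/2" "\<bar>?G c1 a2\<bar> = 1/2" "\<bar>?G c1 b1\<bar> = 1/2" "\<bar>?G c1 b2\<bar> = 1/2"
      by (unfold g; rule half; use ne K01 in metis)+
  qed (simp_all add: G ka kb kc aa bb K_eqs)
qed

text \<open>What remains of the projection argument when all other neighbours of \<open>a\<close>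
  and \<open>b\<close> lie in one class of the dual lattice. The two possible classes differ by
  exchanging \<open>a\<close> and \<open>b\<close>, hence the orientation.\<close>

definition oriented_diamond :: "'v \<Rightarrow> 'v \<Rightarrow> 'v \<Rightarrow> 'v \<Rightarrow> bool" where
  "oriented_diamond a b p z \<longleftrightarrow>
     (\<forall>v. H a v \<and> v \<noteq> p \<and> v \<noteq> z \<longrightarrow> \<not> H b v \<and> (H p v \<longleftrightarrow> H z v)) \<and>
     (\<forall>v. H b v \<and> v \<noteq> p \<and> v \<noteq> z \<longrightarrow> \<not> H a v \<and> (H p v \<longleftrightarrow> \<not> H z v)) \<and>
     (\<forall>v w. H a v \<and> H a w \<and> v \<notin> {p, z} \<and> w \<notin> {p, z} \<and> v \<noteq> w \<longrightarrow> (H v w \<longleftrightarrow> (H p v \<longleftrightarrow> H p w)))"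

text \<open>Orthogonally to the diamond, the remaining neighbours of \<open>a\<close> and
  \<open>b\<close> become unit vectors in three classes. Regularity provides five of them, so only
  one class occurs, and the vanishing inner products then determine their adjacencies.\<close>

lemma diamond_orientation:
  assumes nab: "a \<noteq> b" "\<not> H a b" and pz: "p \<noteq> z"
    and H: "H a p" "H a z" "H b p" "H b z"
  shows "oriented_diamond a b p z \<or> oriented_diamond b a p z"
proof -
  have Hpz: "H p z" using no_induced_four_cycle[of a p b z] assms H_commute by blast
  note sy = H[unfolded H_commute[of a] H_commute[of b]] Hpz nab(2)[unfolded H_commute[of a]]
  have ne: "a \<noteq> p" "a \<noteq> z" "b \<noteq> p" "b \<noteq> z" using H H_irrefl by auto
  let ?G = "schur (schur (schur (schur K a) b) p) z"
  have pd: "pd_on (UNIV - {a} - {b} - {p} - {z}) ?G"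
    using ne nab pz by (intro pd_on_schur H_pd) auto
  have G: "?G v w = K v w - (K v a * K w a + K v b * K w b) / 2
      - (K v p - (K v a + K v b) / 2) * (K w p - (K w a + K w b) / 2)
      - (K v z - (K v a + K v b) / 2) * (K w z - (K w a + K w b) / 2)" for v w
    by (rule schur_diamond, rule K_sym) (use H nab sy in \<open>auto simp: K_eqs\<close>)
  define X where "X = {v. (H a v \<or> H b v) \<and> v \<noteq> p \<and> v \<noteq> z}"
  have Xne: "v \<noteq> a" "v \<noteq> b" "v \<noteq> p" "v \<noteq> z" if "v \<in> X" for v
    using that nab sy H_irrefl by (auto simp: X_def)
  \<comment> \<open>The class modulo the \<open>D\<^sub>4\<close> lattice. Class 2 is adjacent to
    both \<open>a\<close> and \<open>b\<close>. In class 0 neighbours of \<open>a\<close> alone see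
    both or neither of \<open>p\<close>, \<open>z\<close>, and neighbours of \<open>b\<close> alone
    see exactly one; class 1 is the reverse.\<close>
  define cls where "cls v = (if H a v \<and> H b v then 2 else if H a v \<longleftrightarrow> (H p v \<longleftrightarrow> H z v) then 0 else 1 :: nat)" for v
  have common: "H p v \<and> H z v" if "v \<in> X" "H a v" "H b v" for v
    using no_induced_four_cycle[of a p b v] no_induced_four_cycle[of a z b v] that H nab sy Xne[OF that(1)] H_commute
    by metis
  have K01: "K v a = of_bool (H a v)" "K v b = of_bool (H b v)" "K v p = of_bool (H p v)" "K v z = of_bool (H z v)"
    if "v \<in> X" for v
    using Xne[OF that] H_commute[of v] by (auto simp: collinearity_gram_def)
  have k0: "K v a = 1 \<and> K v b = 0 \<and> K v p = 0 \<and> K v z = 0 \<or> K v a = 1 \<and> K v b = 0 \<and> K v p = 1 \<and> K v z = 1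
      \<or> K v a = 0 \<and> K v b = 1 \<and> K v p = 1 \<and> K v z = 0 \<or> K v a = 0 \<and> K v b = 1 \<and> K v p = 0 \<and> K v z = 1"
    if "v \<in> X" "cls v = 0" for v
    using that unfolding K01[OF that(1)] by (auto simp: X_def cls_def split: if_splits)
  have k1: "K v a = 0 \<and> K v b = 1 \<and> K v p = 0 \<and> K v z = 0 \<or> K v a = 0 \<and> K v b = 1 \<and> K v p = 1 \<and> K v z = 1
      \<or> K v a = 1 \<and> K v b = 0 \<and> K v p = 1 \<and> K v z = 0 \<or> K v a = 1 \<and> K v b = 0 \<and> K v p = 0 \<and> K v z = 1"
    if "v \<in> X" "cls v = 1" for v
    using that unfolding K01[OF that(1)] by (auto simp: X_def cls_def split: if_splits)
  have k2: "K v a = 1 \<and> K v b = 1 \<and> K v p = 1 \<and> K v z = 1" if "v \<in> X" "cls v = 2" for v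
    using that common[OF that(1)] unfolding K01[OF that(1)] by (auto simp: cls_def split: if_splits)
  have cls3: "cls v = 0 \<or> cls v = 1 \<or> cls v = 2" for v by (auto simp: cls_def)
  have Kvw: "K v w = 0 \<or> K v w = 1" if "v \<noteq> w" for v w using K_cases[OF that] by blast
  have diag: "?G v v = 1" if "v \<in> X" for v
    using cls3[of v] k0[OF that] k1[OF that] k2[OF that] unfolding G K_eqs(1) by fastforce
  have mem: "v \<in> UNIV - {a} - {b} - {p} - {z}" if "v \<in> X" for v using Xne[OF that] by auto
  have lt1: "(?G v w)\<^sup>2 < 1" if "v \<in> X" "w \<in> X" "v \<noteq> w" for v w
    using pd_on_minor[OF pd mem[OF that(1)] mem[OF that(2)] that(3)] that by (simp only: diag mult_1)
  \<comment> \<open>Within a class the inner product is an integer, between classes an odd multiple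
    of 1/2. The bound \<open>lt1\<close> leaves only 0 and 1/2 in absolute value.\<close>
  have same: "?G v w = 0" if X: "v \<in> X" "w \<in> X" and vw: "v \<noteq> w" and cc: "cls v = cls w" for v w
  proof -
    consider "cls v = 0" "cls w = 0" | "cls v = 1" "cls w = 1" | "cls v = 2" "cls w = 2"
      using cls3[of v] cc by auto
    then show ?thesis
    proof cases
      case 1
      show ?thesis using Kvw[OF vw] k0[OF X(1) 1(1)] k0[OF X(2) 1(2)] lt1[OF X vw]
        unfolding G by (elim disjE conjE) (simp_all add: power2_eq_square)
    next
      case 2
      show ?thesis using Kvw[OF vw] k1[OF X(1) 2(1)] k1[OF X(2) 2(2)] lt1[OF X vw]
        unfolding G by (elim disjE conjE) (simp_all add: power2_eq_square)
    next
      case 3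
      show ?thesis using Kvw[OF vw] k2[OF X(1) 3(1)] k2[OF X(2) 3(2)] lt1[OF X vw]
        unfolding G by (elim disjE conjE) (simp_all add: power2_eq_square)
    qed
  qed
  have diff01: "\<bar>?G v w\<bar> = 1/2" if X: "v \<in> X" "w \<in> X" and cc: "cls v < cls w" for v w
  proof -
    have vw: "v \<noteq> w" using cc by auto
    consider "cls v = 0" "cls w = 1" | "cls v = 0" "cls w = 2" | "cls v = 1" "cls w = 2"
      using cls3[of v] cls3[of w] cc by auto
    then show ?thesis
    proof cases
      case 1
      show ?thesis using Kvw[OF vw] k0[OF X(1) 1(1)] k1[OF X(2) 1(2)] lt1[OF X vw]
        unfolding G by (elim disjE conjE) (simp_all add: power2_eq_square)
    next
      case 2
      show ?thesis using Kvw[OF vw] k0[OF X(1) 2(1)] k2[OF X(2) 2(2)] lt1[OF X vw]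
        unfolding G by (elim disjE conjE) (simp_all add: power2_eq_square)
    next
      case 3
      show ?thesis using Kvw[OF vw] k1[OF X(1) 3(1)] k2[OF X(2) 3(2)] lt1[OF X vw]
        unfolding G by (elim disjE conjE) (simp_all add: power2_eq_square)
    qed
  qed
  have diff: "\<bar>?G v w\<bar> = 1/2" if "v \<in> X" "w \<in> X" "cls v \<noteq> cls w" for v w
    using diff01[of v w] diff01[of w v] that pd_on_sym[OF pd, of v w] by linarith
  have priv: "\<exists>v. H a v \<and> v \<noteq> p \<and> v \<noteq> z \<and> \<not> H b v" if "a \<noteq> b" "\<not> H a b" "H a p" "H b p" for a b
  proof -
    have "b \<in> {v. H p v \<and> v \<noteq> a \<and> \<not> H v a}" using that H_commute by auto
    then have "card {v. H p v \<and> v \<noteq> a \<and> \<not> H v a} \<noteq> 0" by (metis card_0_eq emptyE finite)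
    then have "{v. H a v \<and> v \<noteq> p \<and> \<not> H v p} \<noteq> {}"
      using card_nbr_diff[OF that(3)] by (metis card.empty)
    then obtain v where "H a v" "v \<noteq> p" "\<not> H v p" by auto
    moreover from this have "\<not> H b v"
      using no_induced_four_cycle[of a p b v] that H_commute by blast
    ultimately show ?thesis using Hpz H_commute by blast
  qed
  obtain a1 where a1: "H a a1" "a1 \<noteq> p" "a1 \<noteq> z" "\<not> H b a1" using priv[of a b] nab H by blast
  \<comment> \<open>At least six neighbours of \<open>b\<close>, without \<open>p\<close> and
    \<open>z\<close>, give four elements of \<open>X\<close>; \<open>a1\<close> is a fifth because
    it is not adjacent to \<open>b\<close>.\<close>
  have card5: "5 \<le> card X"
  proof -
    have "{v. H b v} \<subseteq> insert p (insert z (X - {a1}))" using a1 by (auto simp: X_def)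
    then have "card {v. H b v} \<le> card (insert p (insert z (X - {a1})))" by (intro card_mono) auto
    also have "\<dots> \<le> Suc (Suc (card (X - {a1})))" by (simp add: card_insert_if)
    also have "a1 \<in> X" using a1 by (simp add: X_def)
    then have "card (X - {a1}) = card X - 1" by simp
    finally show ?thesis using H_regular[of b] r_ge by linarith
  qed
  have sub: "X \<subseteq> UNIV - {a} - {b} - {p} - {z}" using mem by blast
  have cls_less: "cls v < 3" for v by (simp add: cls_def)
  have const: "cls u = cls v" if "u \<in> X" "v \<in> X" for u v
    by (rule pd_on_half_single_class[OF pd sub card5 cls_less diag same diff that])
  have a1X: "a1 \<in> X" "cls a1 \<noteq> 2" using a1 by (auto simp: X_def cls_def)
  have no2: "\<not> (H a v \<and> H b v)" if "v \<in> X" for v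
    using const[OF that a1X(1)] a1X(2) by (auto simp: cls_def)
  have adj: "H v w \<longleftrightarrow> (H p v \<longleftrightarrow> H p w)" if "v \<in> X" "w \<in> X" "v \<noteq> w" "H a v \<longleftrightarrow> H a w" for v w
  proof -
    have "K v w = of_bool (H v w)" using that(3) by (simp add: collinearity_gram_def)
    moreover have "?G v w = 0" by (rule same[OF that(1-3) const[OF that(1,2)]])
    moreover have "H a v \<or> H b v" "H a w \<or> H b w" using that by (auto simp: X_def)
    ultimately show ?thesis
      using no2[OF that(1)] no2[OF that(2)] const[OF that(1,2)] that(4)
      unfolding G K01[OF that(1)] K01[OF that(2)] cls_def
      by (auto simp: of_bool_def split: if_splits)
  qed
  have "cls a1 = 0 \<or> cls a1 = 1" using cls3[of a1] a1X by auto
  then show ?thesis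
  proof
    assume 0: "cls a1 = 0"
    then have c: "cls v = 0" if "v \<in> X" for v using const[OF that a1X(1)] by simp
    have "oriented_diamond a b p z"
      unfolding oriented_diamond_def
    proof (intro conjI allI impI; (elim conjE)?)
      fix v assume "H a v" "v \<noteq> p" "v \<noteq> z"
      then show "\<not> H b v" "H p v = H z v" using c[of v] no2[of v] by (auto simp: X_def cls_def split: if_splits)
    next
      fix v assume "H b v" "v \<noteq> p" "v \<noteq> z"
      then show "\<not> H a v" "H p v = (\<not> H z v)" using c[of v] no2[of v] by (auto simp: X_def cls_def split: if_splits)
    next
      fix v w assume "H a v" "H a w" "v \<notin> {p, z}" "w \<notin> {p, z}" "v \<noteq> w"
      then show "H v w = (H p v = H p w)" by (intro adj) (auto simp: X_def)
    qed
    then show ?thesis ..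
  next
    assume 1: "cls a1 = 1"
    then have c: "cls v = 1" if "v \<in> X" for v using const[OF that a1X(1)] by simp
    have "oriented_diamond b a p z"
      unfolding oriented_diamond_def
    proof (intro conjI allI impI; (elim conjE)?)
      fix v assume "H a v" "v \<noteq> p" "v \<noteq> z"
      then show "\<not> H b v" "H p v = (\<not> H z v)" using c[of v] no2[of v] by (auto simp: X_def cls_def split: if_splits)
    next
      fix v assume "H b v" "v \<noteq> p" "v \<noteq> z"
      then show "\<not> H a v" "H p v = H z v" using c[of v] no2[of v] by (auto simp: X_def cls_def split: if_splits)
    next
      fix v w assume "H b v" "H b w" "v \<notin> {p, z}" "w \<notin> {p, z}" "v \<noteq> w"
      moreover from this have "v \<in> X" "w \<in> X" by (auto simp: X_def)
      ultimately show "H v w = (H p v = H p w)" using no2[of v] no2[of w] by (intro adj) auto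
    qed
    then show ?thesis ..
  qed
qed

text \<open>The neighbourhood of \<open>a\<close> is the disjoint union of two non-empty cliques.\<close>

definition split_nbhd :: "'v \<Rightarrow> ('v \<Rightarrow> bool) \<Rightarrow> bool" where
  "split_nbhd a \<phi> \<longleftrightarrow> (\<exists>v w. H a v \<and> H a w \<and> \<phi> v \<and> \<not> \<phi> w) \<and>
     (\<forall>v w. H a v \<and> H a w \<and> v \<noteq> w \<longrightarrow> (H v w \<longleftrightarrow> \<phi> v = \<phi> w))"

text \<open>One clique consists of \<open>p\<close>, \<open>z\<close> and the neighbours of
  \<open>a\<close> adjacent to both, the other of those adjacent to neither. Regularity along the
  edge from \<open>a\<close> to \<open>p\<close> makes the second clique non-empty.\<close>

lemma oriented_diamond_split:
  assumes od: "oriented_diamond a b p z" and "a \<noteq> b" "\<not> H a b" "p \<noteq> z"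
    and H: "H a p" "H a z" "H b p" "H b z"
  shows "\<exists>\<phi>. split_nbhd a \<phi>"
proof -
  have Hpz: "H p z" using no_induced_four_cycle[of a p b z] assms H_commute by blast
  have "b \<in> {v. H p v \<and> v \<noteq> a \<and> \<not> H v a}" using assms H_commute by auto
  then have "card {v. H p v \<and> v \<noteq> a \<and> \<not> H v a} \<noteq> 0" by (metis card_0_eq emptyE finite)
  then have "{v. H a v \<and> v \<noteq> p \<and> \<not> H v p} \<noteq> {}"
    using card_nbr_diff[OF H(1)] by (metis card.empty)
  then obtain u where u: "H a u" "u \<noteq> p" "\<not> H u p" by auto
  let ?\<phi> = "\<lambda>v. v = p \<or> v = z \<or> H p v"
  have "u \<noteq> z" using u Hpz H_commute by auto
  then have 1: "\<exists>v w. H a v \<and> H a w \<and> ?\<phi> v \<and> \<not> ?\<phi> w"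
    using u H H_commute by blast
  have o1: "H p v \<longleftrightarrow> H z v" if "H a v" "v \<noteq> p" "v \<noteq> z" for v
    using od that unfolding oriented_diamond_def by blast
  have o3: "H v w \<longleftrightarrow> (H p v \<longleftrightarrow> H p w)"
    if "H a v" "H a w" "v \<noteq> w" "v \<notin> {p, z}" "w \<notin> {p, z}" for v w
    using od that unfolding oriented_diamond_def by blast
  have adj: "H v w \<longleftrightarrow> ?\<phi> v = ?\<phi> w" if "H a v" "H a w" "v \<noteq> w" for v w
  proof -
    have e: "H x w \<longleftrightarrow> ?\<phi> w" if "x \<in> {p, z}" "H a w" "w \<noteq> x" for x w
      using that o1[of w] Hpz H_sym[OF Hpz] by auto
    show ?thesis
      using e[of v w] e[of w v] o3[OF that] that H_commute[of v w]
      by (cases "v \<in> {p, z}"; cases "w \<in> {p, z}") blast+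
  qed
  have "split_nbhd a ?\<phi>"
    unfolding split_nbhd_def
  proof (intro conjI allI impI, rule 1, elim conjE)
    fix v w assume "H a v" "H a w" "v \<noteq> w"
    then show "H v w \<longleftrightarrow> ?\<phi> v = ?\<phi> w" by (rule adj)
  qed
  then show ?thesis by blast
qed

text \<open>A diamond yields a split neighbourhood at one of its ends. Without diamonds adjacency is
  transitive on the neighbours of \<open>p\<close>, and \<open>claw_free\<close> allows at most two
  classes there.\<close>

lemma nonclique_split:
  assumes H: "H p a" "H p b" and "a \<noteq> b" "\<not> H a b"
  shows "\<exists>c \<phi>. split_nbhd c \<phi>"
proof (cases "\<exists>a b p z. a \<noteq> b \<and> \<not> H a b \<and> p \<noteq> z \<and> H a p \<and> H a z \<and> H b p \<and> H b z")
  case True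
  then obtain a b p z where *: "a \<noteq> b" "\<not> H a b" "p \<noteq> z" "H a p" "H a z" "H b p" "H b z" by blast
  then show ?thesis
    using diamond_orientation[OF *] oriented_diamond_split[of a b p z] oriented_diamond_split[of b a p z] H_commute[of a b] by metis
next
  case False
  then have tr: "H v w" if "H p v" "H p w" "H p x" "v \<noteq> w" "H v x" "H x w" for v w x
    using that H_commute H_irrefl by metis
  let ?\<phi> = "\<lambda>v. v = a \<or> H v a"
  have "H v w \<longleftrightarrow> ?\<phi> v = ?\<phi> w" if "H p v" "H p w" "v \<noteq> w" for v w
    using tr[of v w a] tr[of v a w] tr[of w a v] claw_free[of p a v w] that assms H_commute by metis
  moreover have "?\<phi> a" "\<not> ?\<phi> b" using assms H_commute by auto
  ultimately have "split_nbhd p ?\<phi>" unfolding split_nbhd_def using H by blast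
  then show ?thesis by blast
qed

end

section \<open>The square of the adjacency matrix and collinearity\<close>

definition collinear_in :: "('v \<Rightarrow> 'v \<Rightarrow> bool) \<Rightarrow> 'v \<Rightarrow> 'v \<Rightarrow> bool" where
  "collinear_in E u v \<longleftrightarrow> u \<noteq> v \<and> (\<exists>w. E u w \<and> E v w)"

text \<open>The entries of \<open>A^2 - t I\<close>, since the square of \<open>A\<close> counts
  common neighbours.\<close>

definition gap_kernel :: "('v \<Rightarrow> 'v \<Rightarrow> bool) \<Rightarrow> real \<Rightarrow> 'v \<Rightarrow> 'v \<Rightarrow> real" where
  "gap_kernel E t u v = real (card {w. E u w \<and> E v w}) - (if u = v then t else 0)"

lemma adjacency_matrix_quadratic:
  fixes E :: "'v::finite \<Rightarrow> 'v \<Rightarrow> bool"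
  assumes "symp E"
  shows "(\<Sum>i\<in>UNIV. \<Sum>j\<in>UNIV. f i * f j * gap_kernel E t i j) =
    (adjacency_matrix E *v vec_lambda f) \<bullet> (adjacency_matrix E *v vec_lambda f) - t * (vec_lambda f \<bullet> vec_lambda f)"
proof -
  let ?a = "\<lambda>u v. of_bool (E u v) :: real"
  have sy: "E u v \<longleftrightarrow> E v u" for u v using assms by (metis sympE)
  have nth: "(adjacency_matrix E *v vec_lambda f) $ w = (\<Sum>u\<in>UNIV. ?a w u * f u)" for w
    by (simp add: matrix_vector_mult_def adjacency_matrix_def of_bool_def)
  have c: "(\<Sum>w\<in>UNIV. ?a w i * ?a w j) = real (card {w. E i w \<and> E j w})" for i j
  proof -
    have "(\<Sum>w\<in>UNIV. ?a w i * ?a w j) = (\<Sum>w\<in>UNIV. if w \<in> {w. E i w \<and> E j w} then 1 else 0)"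
      by (intro sum.cong) (auto simp: sy)
    then show ?thesis by (simp add: sum.If_cases)
  qed
  have "(adjacency_matrix E *v vec_lambda f) \<bullet> (adjacency_matrix E *v vec_lambda f)
      = (\<Sum>w\<in>UNIV. \<Sum>i\<in>UNIV. \<Sum>j\<in>UNIV. (?a w i * f i) * (?a w j * f j))"
    by (simp only: inner_vec_def nth inner_real_def sum_product)
  also have "\<dots> = (\<Sum>i\<in>UNIV. \<Sum>w\<in>UNIV. \<Sum>j\<in>UNIV. (?a w i * f i) * (?a w j * f j))"
    by (rule sum.swap)
  also have "\<dots> = (\<Sum>i\<in>UNIV. \<Sum>j\<in>UNIV. \<Sum>w\<in>UNIV. (?a w i * f i) * (?a w j * f j))"
    by (intro sum.cong refl sum.swap)
  also have "\<dots> = (\<Sum>i\<in>UNIV. \<Sum>j\<in>UNIV. f i * f j * real (card {w. E i w \<and> E j w}))"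
    unfolding c[symmetric] sum_distrib_left by (intro sum.cong refl) (simp add: mult_ac)
  finally have 1: "(adjacency_matrix E *v vec_lambda f) \<bullet> (adjacency_matrix E *v vec_lambda f)
    = (\<Sum>i\<in>UNIV. \<Sum>j\<in>UNIV. f i * f j * real (card {w. E i w \<and> E j w}))" .
  have "(\<Sum>i\<in>UNIV. \<Sum>j\<in>UNIV. f i * f j * (if i = j then t else 0)) = (\<Sum>i\<in>UNIV. f i * f i * t)"
    by (intro sum.cong refl) (simp add: if_distrib[of "\<lambda>x. _ * x"] cong: if_cong)
  also have "\<dots> = t * (vec_lambda f \<bullet> vec_lambda f)"
    by (simp add: inner_vec_def sum_distrib_left mult_ac)
  finally show ?thesis
    unfolding gap_kernel_def right_diff_distrib sum_subtractf 1 by simp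
qed

lemma transpose_adjacency_matrix: "symp E \<Longrightarrow> transpose (adjacency_matrix E) = adjacency_matrix E"
  by (auto simp: transpose_def adjacency_matrix_def vec_eq_iff dest: sympD)

lemma pd_gap_kernel:
  fixes E :: "'v::finite \<Rightarrow> 'v \<Rightarrow> bool"
  assumes sym: "symp E" and t: "0 \<le> t"
    and lt: "sqrt t < Min (abs ` matrix_spectrum (adjacency_matrix E))"
  shows "pd_on UNIV (gap_kernel E t)"
proof -
  have "0 < (\<Sum>i\<in>UNIV. \<Sum>j\<in>UNIV. f i * f j * gap_kernel E t i j)" if "\<exists>i\<in>UNIV. f i \<noteq> 0" for f
  proof -
    have "vec_lambda f \<noteq> 0" using that by (auto simp: vec_eq_iff)
    then show ?thesis
      using Min_abs_spectrum_greater[OF transpose_adjacency_matrix[OF sym] _ lt, of "vec_lambda f"] t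
      unfolding adjacency_matrix_quadratic[OF sym] by simp
  qed
  moreover have "gap_kernel E t u v = gap_kernel E t v u" for u v
    by (simp add: gap_kernel_def conj_commute)
  ultimately show ?thesis unfolding pd_on_def by auto
qed

section \<open>Graphs without small eigenvalues\<close>

locale gap_graph =
  fixes E :: "'v::finite \<Rightarrow> 'v \<Rightarrow> bool" and d :: nat
  assumes E_sym: "E u v \<Longrightarrow> E v u" and E_irrefl: "\<not> E u u" and d_ge: "3 \<le> d"
    and deg_le: "card {w. E v w} \<le> d"
    and E_pd: "pd_on UNIV (gap_kernel E (real d - 2))"
begin

abbreviation "C \<equiv> collinear_in E"
abbreviation "N v \<equiv> {w. E v w}"
abbreviation "g \<equiv> gap_kernel E (real d - 2)"

lemma E_commute: "E u v \<longleftrightarrow> E v u" using E_sym by blast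

lemma C_commute: "C u v \<longleftrightarrow> C v u" by (auto simp: collinear_in_def)

lemma CI: "E u l \<Longrightarrow> E v l \<Longrightarrow> u \<noteq> v \<Longrightarrow> C u v" by (auto simp: collinear_in_def)

lemma g_diag: "g v v = real (card (N v)) - (real d - 2)" by (simp add: gap_kernel_def)

lemma deg_ge: "d - 1 \<le> card (N v)"
  using pd_on_diag[OF E_pd, of v] d_ge by (simp add: g_diag)

lemma deg_cases: "card (N v) = d \<or> card (N v) = d - 1"
  using deg_ge[of v] deg_le[of v] by linarith

text \<open>Diagonal entries are at most 2, so the off-diagonal codegree is less than 2 in absolute
  value by strict Cauchy-Schwarz.\<close>

lemma codegree_le: "u \<noteq> v \<Longrightarrow> card {w. E u w \<and> E v w} \<le> 1"
proof -
  assume uv: "u \<noteq> v"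
  let ?k = "card {w. E u w \<and> E v w}"
  have "(g u v)\<^sup>2 < g u u * g v v" by (rule pd_on_minor[OF E_pd]) (use uv in auto)
  also have "\<dots> \<le> 2 * 2"
    using pd_on_diag[OF E_pd, of u] pd_on_diag[OF E_pd, of v] deg_le[of u] deg_le[of v]
    by (intro mult_mono) (auto simp: g_diag)
  finally have "(real ?k)\<^sup>2 < 2\<^sup>2" using uv by (simp add: gap_kernel_def)
  then have "real ?k < 2" by (rule power_less_imp_less_base) simp
  then show ?thesis by simp
qed

lemma line_unique: "u \<noteq> v \<Longrightarrow> E u l \<Longrightarrow> E v l \<Longrightarrow> E u m \<Longrightarrow> E v m \<Longrightarrow> l = m"
  using codegree_le[of u v] card_le_Suc0_iff_eq[of "{w. E u w \<and> E v w}"] by auto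

lemma g_off: "u \<noteq> v \<Longrightarrow> g u v = of_bool (C u v)"
proof -
  assume uv: "u \<noteq> v"
  have "card {w. E u w \<and> E v w} = of_bool (C u v)"
  proof (cases "C u v")
    case True
    then have "{w. E u w \<and> E v w} \<noteq> {}" by (auto simp: collinear_in_def)
    then have "card {w. E u w \<and> E v w} \<noteq> 0" by (metis card_0_eq finite)
    then have "card {w. E u w \<and> E v w} = 1" using codegree_le[OF uv] by linarith
    then show ?thesis using True by simp
  next
    case False
    then have "{w. E u w \<and> E v w} = {}" using uv by (auto simp: collinear_in_def)
    then show ?thesis using False by simp
  qed
  then show ?thesis using uv by (simp add: gap_kernel_def)
qed

lemma card_collinear: "card {x. C v x} = (\<Sum>l\<in>N v. card (N l) - 1)"
proof -
  have "{x. C v x} = (\<Union>l\<in>N v. N l - {v})"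
    using E_commute by (auto simp: collinear_in_def)
  also have "card \<dots> = (\<Sum>l\<in>N v. card (N l - {v}))"
  proof (intro card_UN_disjoint ballI impI)
    fix l k assume "l \<in> N v" "k \<in> N v" "l \<noteq> k"
    then have "x = v" if "E l x" "E k x" for x
      using line_unique[of v x l k] that E_sym by (metis mem_Collect_eq)
    then show "(N l - {v}) \<inter> (N k - {v}) = {}" by auto
  qed auto
  also have "\<dots> = (\<Sum>l\<in>N v. card (N l) - 1)"
    using E_commute by (intro sum.cong refl) (simp add: card_Diff_singleton)
  finally show ?thesis .
qed

text \<open>Joining \<open>q\<close> to the points of \<open>l\<close> is injective, since two
  points with the same join would put \<open>q\<close> on \<open>l\<close>. By the cardinalities it
  reaches every line through \<open>q\<close>.\<close>

lemma all_lines_meet: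
  assumes q: "\<not> E q l" "\<And>y. E l y \<Longrightarrow> C q y" and card: "card (N q) \<le> card (N l)" and m: "E q m"
  shows "\<exists>y. E l y \<and> E y m"
proof -
  have "\<forall>y\<in>N l. \<exists>k. E q k \<and> E y k" using q(2) by (auto simp: collinear_in_def)
  then obtain h where h: "\<And>y. E l y \<Longrightarrow> E q (h y) \<and> E y (h y)" by (metis mem_Collect_eq)
  have "inj_on h (N l)"
  proof (rule inj_onI, rule ccontr)
    fix x y assume *: "x \<in> N l" "y \<in> N l" "h x = h y" "x \<noteq> y"
    then have "h x = l" using line_unique[of x y "h x" l] h E_commute by (metis mem_Collect_eq)
    then show False using h[of x] * q(1) by auto
  qed
  then have "card (h ` N l) = card (N l)" by (rule card_image)
  then have "h ` N l = N q" using h card by (intro card_seteq) auto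
  then show ?thesis using m h by (metis image_iff mem_Collect_eq)
qed

lemma obtain_on_line:
  assumes "card A < card (N l)"
  obtains x where "E l x" "x \<notin> A"
proof -
  have "\<not> N l \<subseteq> A" using assms card_mono[of A "N l"] by auto
  then show ?thesis using that by auto
qed

lemma low_not_collinear:
  assumes "card (N u) = d - 1" "card (N v) = d - 1"
  shows "\<not> C u v"
proof
  assume C: "C u v"
  then have "u \<noteq> v" by (simp add: collinear_in_def)
  then have "(g u v)\<^sup>2 < g u u * g v v" by (intro pd_on_minor[OF E_pd]) auto
  then show False using C \<open>u \<noteq> v\<close> assms d_ge by (simp add: g_off g_diag of_nat_diff)
qed

text \<open>The vertex \<open>u\<close> has squared norm 1 and its neighbours 2. Orthogonally to
  \<open>u\<close>, non-collinear \<open>v\<close> and \<open>w\<close> would be unit vectors with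
  inner product -1.\<close>

lemma low_nbhd_clique:
  assumes low: "card (N u) = d - 1" and C: "C u v" "C u w" and "v \<noteq> w"
  shows "C v w"
proof (rule ccontr)
  assume n: "\<not> C v w"
  have ne: "v \<noteq> u" "w \<noteq> u" using C by (auto simp: collinear_in_def)
  have "pd_on (UNIV - {u}) (schur g u)" by (intro pd_on_schur E_pd) auto
  then have "(schur g u v w)\<^sup>2 < schur g u v v * schur g u w w"
    by (rule pd_on_minor) (use assms ne in auto)
  moreover have "g v v \<le> 2" "g w w \<le> 2" "g u u = 1"
    using deg_le[of v] deg_le[of w] low d_ge by (auto simp: g_diag of_nat_diff)
  moreover have "g v v = 2" "g w w = 2"
    using deg_cases[of v] deg_cases[of w] low_not_collinear[OF low] C by (auto simp: g_diag)
  moreover have "g v w = 0" "g v u = 1" "g u v = 1" "g w u = 1" "g u w = 1"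
    using n C C[unfolded C_commute[of u]] ne \<open>v \<noteq> w\<close> by (simp_all add: g_off)
  ultimately show False by (simp add: schur_def)
qed

text \<open>Orthogonally to \<open>u\<close>, the vectors of \<open>v\<close> and \<open>v'\<close>
  are orthonormal and each has inner product 1 with \<open>w\<close>, which exhausts the squared
  norm 2 of \<open>w\<close>.\<close>

lemma low_outside_unique:
  assumes low: "card (N u) = d - 1" and C: "C u v" "C u v'" and "v \<noteq> v'"
    and w: "w \<noteq> u" "\<not> C u w" "C w v" "C w v'"
  shows False
proof -
  have ne: "v \<noteq> u" "v' \<noteq> u" "w \<noteq> v" "w \<noteq> v'" using C w by (auto simp: collinear_in_def)
  have vv: "C v v'" by (rule low_nbhd_clique[OF low]) (use assms in auto)
  have "pd_on (UNIV - {u} - {v} - {v'}) (schur (schur (schur g u) v) v')"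
    using ne \<open>v \<noteq> v'\<close> by (intro pd_on_schur E_pd) auto
  then have *: "0 < schur (schur (schur g u) v) v' w w"
    by (rule pd_on_diag) (use assms ne in auto)
  have "g w w \<le> 2" "g u u = 1" using deg_le[of w] low d_ge by (auto simp: g_diag of_nat_diff)
  moreover have "g v v = 2" "g v' v' = 2"
    using deg_cases[of v] deg_cases[of v'] low_not_collinear[OF low] C by (auto simp: g_diag)
  ultimately show False
    using * ne ne[symmetric] assms(4) assms(4)[symmetric] w C vv w[unfolded C_commute[of w]] C[unfolded C_commute[of u]] vv[unfolded C_commute[of v]]
      w(2)[unfolded C_commute[of u]]
    by (simp add: schur_def g_off)
qed

text \<open>If \<open>u\<close> had degree \<open>d - 1\<close>, counting would give some
  \<open>v\<close> collinear with \<open>u\<close> a collinear \<open>w\<close> that is not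
  collinear with \<open>u\<close>. The line through \<open>v\<close> and \<open>w\<close> meets a
  full line through \<open>u\<close> in a second such point, against
  \<open>low_outside_unique\<close>.\<close>

lemma regular: "card (N v) = d"
proof (rule ccontr)
  assume "card (N v) \<noteq> d"
  then obtain u where low: "card (N u) = d - 1" using deg_cases by blast
  have "2 \<le> card (N u)" using low d_ge by simp
  then obtain l1 l2 where l12: "E u l1" "E u l2" "l1 \<noteq> l2"
    using card_ge_2_obtain[of "N u"] by auto
  have "C l1 l2" using l12 E_commute by (intro CI[of _ u]) auto
  then obtain l l' where l: "E u l" "E u l'" "l \<noteq> l'" "card (N l') = d"
    using l12 low_not_collinear[of l1 l2] deg_cases[of l1] deg_cases[of l2] by metis
  have "card {u} < card (N l)" using deg_ge[of l] d_ge by simp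
  then obtain v where v: "E l v" "v \<notin> {u}" using obtain_on_line by blast
  have Cuv: "C u v" using l v E_commute by (intro CI[of _ l]) auto
  have high: "card (N v) = d" using deg_cases[of v] low_not_collinear[OF low] Cuv by blast
  have nvl': "\<not> E v l'" using line_unique[of u v l l'] l v E_commute by auto
  have le: "card {x. C u x} \<le> (d - 1) * (d - 1)"
  proof -
    have "card {x. C u x} \<le> (\<Sum>l\<in>N u. d - 1)"
      unfolding card_collinear using deg_le by (intro sum_mono diff_le_mono)
    then show ?thesis using low by simp
  qed
  \<comment> \<open>At most one line through \<open>v\<close> has only \<open>d - 1\<close> points,
    because two such lines would be collinear via \<open>v\<close>; hence the loss of at most
    1.\<close>
  have ge: "d * (d - 1) - 1 \<le> card {x. C v x}"
  proof (cases "\<exists>k\<in>N v. card (N k) = d - 1")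
    case True
    then obtain k where k: "E v k" "card (N k) = d - 1" by auto
    have "card (N m) = d" if "m \<in> N v - {k}" for m
    proof -
      have "C k m" using that k E_commute by (intro CI[of _ v]) auto
      then show ?thesis using low_not_collinear[OF k(2)] deg_cases[of m] by blast
    qed
    then have "(\<Sum>m\<in>N v - {k}. card (N m) - 1) = (\<Sum>m\<in>N v - {k}. d - 1)" by (intro sum.cong) auto
    also have "\<dots> = (d - 1) * (d - 1)" using high k by (simp add: card_Diff_singleton)
    finally have "card {x. C v x} = (d - 1 - 1) + (d - 1) * (d - 1)"
      unfolding card_collinear using k by (subst sum.remove[of _ k]) auto
    moreover have "d = Suc (Suc (d - 2))" using d_ge by simp
    then obtain e where "d = Suc (Suc e)" ..
    ultimately show ?thesis by simp
  next
    case False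
    then have "card (N m) = d" if "m \<in> N v" for m using deg_cases[of m] that by blast
    then show ?thesis unfolding card_collinear using high by simp
  qed
  have "\<exists>w. C v w \<and> w \<noteq> u \<and> \<not> C u w"
  proof (rule ccontr)
    assume "\<not> ?thesis"
    then have "{x. C v x} - {u} \<subseteq> {x. C u x} - {v}" by (auto simp: collinear_in_def)
    then have "card ({x. C v x} - {u}) \<le> card ({x. C u x} - {v})" by (intro card_mono) auto
    then have "card {x. C v x} - 1 \<le> card {x. C u x} - 1"
      using Cuv C_commute by (simp add: card_Diff_singleton)
    moreover have "d = Suc (Suc (Suc (d - 3)))" using d_ge by simp
    then obtain e where "d = Suc (Suc (Suc e))" ..
    ultimately show False using le ge by simp
  qed
  then obtain w where w: "C v w" "w \<noteq> u" "\<not> C u w" by blast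
  then obtain m where m: "E v m" "E w m" by (auto simp: collinear_in_def)
  have Cvy: "C v y" if "E l' y" for y
  proof (cases "y = u")
    case True then show ?thesis using Cuv C_commute by auto
  next
    case False
    then have "C u y" using that l E_commute by (intro CI[of _ l']) auto
    moreover have "v \<noteq> y" using that nvl' E_commute by auto
    ultimately show ?thesis using low_nbhd_clique[OF low Cuv] by blast
  qed
  obtain y where y: "E l' y" "E y m"
    using all_lines_meet[OF nvl' Cvy _ m(1)] high l(4) by auto
  have "y \<noteq> u" using y m w CI[of u m w] by auto
  then have Cuy: "C u y" using y l E_commute by (intro CI[of _ l']) auto
  have "v \<noteq> y" using y nvl' E_commute by auto
  moreover have "C w y" using Cuy w y m by (intro CI[of _ m]) auto
  ultimately show False using low_outside_unique[OF low Cuv Cuy] w C_commute by blast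
qed

lemma card_collinear_eq: "card {x. C v x} = d * (d - 1)"
  unfolding card_collinear regular by (simp add: regular)

sublocale pd_regular C "d * (d - 1)"
proof
  show "6 \<le> d * (d - 1)"
    using mult_le_mono[of 3 d 2 "d - 1"] d_ge by simp
  have "g = collinearity_gram C"
    by (auto simp: fun_eq_iff collinearity_gram_def g_off g_diag regular)
  then show "pd_on UNIV (collinearity_gram C)" using E_pd by simp
qed (auto simp: collinear_in_def card_collinear_eq[unfolded collinear_in_def])

text \<open>Of three lines through \<open>a\<close>, two have points in the same clique. A point
  \<open>q\<close> of one of them is then collinear with all of the other, and its neighbours turn
  out to be those of \<open>a\<close>. But \<open>q\<close> misses the second clique.\<close>

lemma no_split_nbhd: "\<not> split_nbhd a \<phi>"
proof
  assume sp: "split_nbhd a \<phi>"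
  have adj: "C v w \<longleftrightarrow> \<phi> v = \<phi> w" if "C a v" "C a w" "v \<noteq> w" for v w
    using sp that unfolding split_nbhd_def by blast
  obtain l1 l2 l3 where l123: "E a l1" "E a l2" "E a l3" "distinct [l1, l2, l3]"
    using card_ge_3_obtain[of "N a"] regular[of a] d_ge by auto
  have pt: "\<exists>x. E l x \<and> x \<noteq> a" for l
    using obtain_on_line[of "{a}" l] regular[of l] d_ge by auto
  obtain x1 x2 x3 where x: "E l1 x1" "x1 \<noteq> a" "E l2 x2" "x2 \<noteq> a" "E l3 x3" "x3 \<noteq> a"
    using pt by meson
  have "\<exists>l l' q y. E a l \<and> E a l' \<and> l \<noteq> l' \<and> E l q \<and> q \<noteq> a \<and> E l' y \<and> y \<noteq> a \<and> \<phi> q = \<phi> y"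
  proof -
    have "\<phi> x1 = \<phi> x2 \<or> \<phi> x1 = \<phi> x3 \<or> \<phi> x2 = \<phi> x3" by auto
    then show ?thesis using x l123 by auto
  qed
  then obtain l l' q y0 where l: "E a l" "E a l'" "l \<noteq> l'" "E l q" "q \<noteq> a" "E l' y0" "y0 \<noteq> a" "\<phi> q = \<phi> y0"
    by blast
  have Caq: "C a q" using l E_commute by (intro CI[of _ l]) auto
  have ql': "\<not> E q l'" using line_unique[of a q l l'] l E_commute by auto
  have Cay: "C a y" if "E l' y" "y \<noteq> a" for y using l E_commute that by (intro CI[of _ l']) auto
  have phi: "\<phi> y = \<phi> q" if "E l' y" "y \<noteq> a" for y
  proof (cases "y = y0")
    case False
    then have "C y y0" using that l E_commute by (intro CI[of _ l']) auto
    then show ?thesis using adj[of y y0] Cay that l False by auto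
  qed (use l in simp)
  have Cqy: "C q y" if "E l' y" for y
  proof (cases "y = a")
    case False
    then show ?thesis using adj[OF Caq Cay[OF that False]] phi[OF that False] ql' that E_commute by auto
  qed (use Caq C_commute in simp)
  obtain o1 where o1: "C a o1" "\<phi> o1 \<noteq> \<phi> q"
    using sp unfolding split_nbhd_def by metis
  have sub: "C a x" if Cqx: "C q x" and xa: "x \<noteq> a" for x
  proof (rule ccontr)
    assume nax: "\<not> C a x"
    obtain m where m: "E q m" "E x m" using Cqx by (auto simp: collinear_in_def)
    obtain y where y: "E l' y" "E y m"
      using all_lines_meet[OF ql' Cqy _ m(1)] regular by auto
    have ya: "y \<noteq> a" using CI[of a m x] y m nax xa by auto
    have xy: "x \<noteq> y" using nax Cay y ya by auto
    have qy: "q \<noteq> y" using y ql' E_commute by auto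
    have qx: "q \<noteq> x" using Cqx by (auto simp: collinear_in_def)
    have Cxy: "C x y" using m y xy by (intro CI[of _ m]) auto
    have "oriented_diamond a x q y \<or> oriented_diamond x a q y"
      using diamond_orientation[of a x q y] nax xa qy Caq Cay[OF y(1) ya] Cqx Cxy C_commute by metis
    \<comment> \<open>This orientation would make every further neighbour of \<open>a\<close>
      collinear with exactly one of \<open>q\<close> and \<open>y\<close>, but \<open>o1\<close> is
      in the other clique and collinear with neither.\<close>
    moreover have "\<not> oriented_diamond x a q y"
    proof -
      have "o1 \<noteq> q" "o1 \<noteq> y" "\<not> C q o1" "\<not> C y o1"
        using o1 phi[OF y(1) ya] adj[OF Caq o1(1)] adj[OF Cay[OF y(1) ya] o1(1)] by metis+
      then show ?thesis using o1 unfolding oriented_diamond_def by blast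
    qed
    ultimately have od: "oriented_diamond a x q y" by blast
    have o1': "\<not> C x v" if "C a v" "v \<noteq> q" "v \<noteq> y" for v
      using od that unfolding oriented_diamond_def by blast
    have o2: "\<not> C a v \<and> (C q v \<longleftrightarrow> \<not> C y v)" if "C x v" "v \<noteq> q" "v \<noteq> y" for v
      using od that unfolding oriented_diamond_def by blast
    \<comment> \<open>A fourth point of \<open>m\<close> would be collinear with \<open>x\<close>
      and with both \<open>q\<close> and \<open>y\<close>, against \<open>o2\<close>.\<close>
    have d3: "d = 3"
    proof (rule ccontr)
      assume "d \<noteq> 3"
      then obtain t where t: "E m t" "t \<notin> {q, x, y}"
        using obtain_on_line[of "{q, x, y}" m] regular[of m] d_ge qy qx xy by auto
      then have "C x t" "C q t" "C y t" using m y E_commute by (auto intro!: CI[of _ m])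
      then show False using o2[of t] t by auto
    qed
    obtain q2 where q2: "E l q2" "q2 \<notin> {a, q}"
      using obtain_on_line[of "{a, q}" l] regular[of l] d3 l by auto
    obtain y2 where y2: "E l' y2" "y2 \<notin> {a, y}"
      using obtain_on_line[of "{a, y}" l'] regular[of l'] d3 ya by auto
    have C2: "C a q2" "C a y2" "C q q2" "C q y2"
      using q2 y2 l Cqy Cay E_commute by (auto intro!: CI[of _ l])
    have ne2: "q2 \<noteq> y2" "q2 \<noteq> y" "y2 \<noteq> q"
      using line_unique[of a q2 l l'] q2 y2 y l ql' E_commute by auto
    have Cy2: "C y q2" "C y y2"
      using adj[of y q2] adj[of q q2] C2 Caq Cay y ya phi[OF y(1) ya] ne2 q2 y2 E_commute
      by (auto intro!: CI[of _ l'])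
    \<comment> \<open>By \<open>o2\<close> all of \<open>?S\<close> is collinear with
      \<open>q\<close>. Its at least three elements and the five vertices \<open>a\<close>,
      \<open>x\<close>, \<open>y\<close>, \<open>q2\<close>, \<open>y2\<close> give \<open>q\<close>
      eight neighbours instead of six.\<close>
    let ?S = "{v. C x v \<and> v \<noteq> y \<and> \<not> C v y}"
    have "{a, q2, y2} \<subseteq> {v. C y v \<and> v \<noteq> x \<and> \<not> C v x}"
      using C2 Cy2 ne2 o1'[of q2] o1'[of y2] q2 y2 nax xa Cay[OF y(1) ya] C_commute by auto
    then have "card {a, q2, y2} \<le> card {v. C y v \<and> v \<noteq> x \<and> \<not> C v x}" by (intro card_mono) auto
    then have S3: "3 \<le> card ?S"
      using card_nbr_diff[OF Cxy] q2 y2 ne2 by (auto simp: card_insert_if)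
    have "?S \<inter> {a, x, y, q2, y2} = {}"
      using nax C2 C_commute o1'[of q2] o1'[of y2] ne2 q2 y2 H_irrefl by auto
    moreover have "x \<noteq> q2" "x \<noteq> y2" using C2 nax by auto
    then have "card {a, x, y, q2, y2} = 5"
      using xa xy ya ne2 q2 y2 by (auto simp: card_insert_if)
    ultimately have "8 \<le> card (?S \<union> {a, x, y, q2, y2})"
      using S3 by (subst card_Un_disjoint) auto
    also have "?S \<union> {a, x, y, q2, y2} \<subseteq> {v. C q v}"
      using o2 C_commute Caq Cqx Cqy[OF y(1)] C2 by auto
    then have "card (?S \<union> {a, x, y, q2, y2}) \<le> card {v. C q v}" by (intro card_mono) auto
    also have "\<dots> = 6" using H_regular[of q] d3 by simp
    finally show False by simp
  qed
  have "{x. C q x} - {a} \<subseteq> {x. C a x} - {q}" using sub H_irrefl by auto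
  moreover have "card ({x. C q x} - {a}) = card ({x. C a x} - {q})"
    using Caq H_sym[OF Caq] by (simp add: card_Diff_singleton H_regular)
  ultimately have "{x. C q x} - {a} = {x. C a x} - {q}" by (intro card_subset_eq) auto
  moreover have "o1 \<noteq> q" using o1 by auto
  ultimately have "C q o1" using o1 by blast
  then show False using adj[OF Caq o1(1)] o1 by auto
qed

lemma C_trans: "C p a \<Longrightarrow> C p b \<Longrightarrow> a \<noteq> b \<Longrightarrow> C a b"
  using nonclique_split no_split_nbhd by blast

end

section \<open>Regular graphs with exactly one common neighbour for any two vertices\<close>

lemma adjacency_matrix_mult_nth:
  "(adjacency_matrix E *v x) $ u = (\<Sum>v\<in>{v. E u v}. x $ v)"
  by (simp add: matrix_vector_mult_def adjacency_matrix_def sum.If_cases if_distrib[of "\<lambda>a. a * _"] cong: if_cong)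

text \<open>On the orthogonal complement of the constant vectors
  the square of \<open>A\<close> is \<open>(d - 1) I\<close>, so \<open>(I + A / sqrt (d - 1)) / 2\<close> restricts to a projection there,
  whose trace has to be an integer.\<close>

lemma regular_friendship_degree:
  fixes E :: "'v::finite \<Rightarrow> 'v \<Rightarrow> bool"
  assumes sym: "symp E" and irr: "irreflp E" and deg: "\<And>v. card {w. E v w} = d"
    and friend: "\<And>u v. u \<noteq> v \<Longrightarrow> card {w. E u w \<and> E v w} = 1" and d: "2 \<le> d"
  shows "d = 2"
proof -
  define A where "A = adjacency_matrix E"
  define one :: "real ^ 'v" where "one = (\<chi> i. 1)"
  define N where "N = real CARD('v)"
  have N0: "N > 0" by (simp add: N_def)
  have sA: "transpose A = A" unfolding A_def by (rule transpose_adjacency_matrix[OF sym])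
  have A_nth: "(A *v x) $ u = (\<Sum>v\<in>{v. E u v}. x $ v)" for x u
    unfolding A_def by (rule adjacency_matrix_mult_nth)
  have sy: "E u v \<longleftrightarrow> E v u" for u v using sym by (metis sympE)
  have oo: "one \<bullet> one = N" by (simp add: one_def inner_vec_def N_def)
  have ox: "one \<bullet> x = (\<Sum>v\<in>UNIV. x $ v)" for x by (simp add: one_def inner_vec_def)
  have A1: "A *v one = real d *\<^sub>R one"
    by (simp add: vec_eq_iff A_nth one_def deg)
  have AA: "A *v (A *v x) = (real d - 1) *\<^sub>R x + (one \<bullet> x) *\<^sub>R one" for x
  proof -
    have "(A *v (A *v x)) $ u = (real d - 1) * x $ u + (one \<bullet> x)" for u
    proof -
      have "(A *v (A *v x)) $ u = (\<Sum>w\<in>{w. E u w}. \<Sum>v\<in>{v. E w v}. x $ v)"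
        by (simp add: A_nth)
      also have "\<dots> = (\<Sum>w\<in>{w. E u w}. \<Sum>v\<in>UNIV. if E w v then x $ v else 0)"
        by (simp add: sum.If_cases)
      also have "\<dots> = (\<Sum>v\<in>UNIV. \<Sum>w\<in>{w. E u w}. if E w v then x $ v else 0)"
        by (rule sum.swap)
      also have "\<dots> = (\<Sum>v\<in>UNIV. real (card {w. E u w \<and> E v w}) * x $ v)"
      proof (intro sum.cong refl)
        fix v
        have "{w. E u w} \<inter> {w. E w v} = {w. E u w \<and> E v w}" using sy by auto
        then show "(\<Sum>w\<in>{w. E u w}. if E w v then x $ v else 0) = real (card {w. E u w \<and> E v w}) * x $ v"
          by (simp add: sum.If_cases)
      qed
      also have "\<dots> = (\<Sum>v\<in>UNIV. (if v = u then (real d - 1) * x $ v else 0) + x $ v)"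
        using friend deg by (intro sum.cong refl) (auto simp: algebra_simps)
      also have "\<dots> = (real d - 1) * x $ u + (one \<bullet> x)"
        by (simp add: sum.distrib ox)
      finally show ?thesis .
    qed
    then show ?thesis by (simp add: vec_eq_iff one_def)
  qed
  define s where "s = sqrt (real d - 1)"
  have s2: "s * s = real d - 1" and s0: "s > 0" using d by (auto simp: s_def)
  define Q where "Q x = x - ((one \<bullet> x) / N) *\<^sub>R one" for x
  \<comment> \<open>The orthogonal projection onto the eigenspace of \<open>A\<close> for
    \<open>s\<close> inside the complement of \<open>one\<close>.\<close>
  define T where "T x = (1/2) *\<^sub>R (Q x + (1/s) *\<^sub>R (A *v Q x))" for x
  have linQ: "linear Q"
    by (rule linearI) (simp_all add: Q_def inner_add_right algebra_simps add_divide_distrib)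
  have linT: "linear T"
    by (rule linearI) (simp_all add: T_def linear_add[OF linQ] linear_scale[OF linQ]
        matrix_vector_right_distrib matrix_vector_mult_scaleR algebra_simps)
  have oQ: "one \<bullet> Q x = 0" for x using N0 by (simp add: Q_def inner_diff_right oo)
  have oA: "one \<bullet> (A *v x) = real d * (one \<bullet> x)" for x
    using symmetric_inner_mult[OF sA, of one x] A1 by simp
  have oT: "one \<bullet> T x = 0" for x by (simp add: T_def inner_add_right oQ oA)
  have QT: "Q (T x) = T x" for x using oT[of x] by (simp add: Q_def[of "T x"])
  have AT: "A *v T x = s *\<^sub>R T x" for x
  proof -
    have "A *v T x = (1/2) *\<^sub>R (A *v Q x + ((real d - 1) / s) *\<^sub>R Q x)"
      by (simp add: T_def matrix_vector_mult_scaleR matrix_vector_right_distrib AA oQ)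
    also have "(real d - 1) / s = s" using s2 s0 by (simp add: field_simps)
    finally show ?thesis using s0 by (simp add: T_def scaleR_add_right add.commute)
  qed
  have TT: "T (T x) = T x" for x
  proof -
    have "T (T x) = (1/2) *\<^sub>R (T x + T x)" using s0 unfolding T_def[of "T x"] QT AT by simp
    then show ?thesis by (simp flip: scaleR_2)
  qed
  have symQ: "Q x \<bullet> y = x \<bullet> Q y" for x y
    by (simp add: Q_def inner_diff_left inner_diff_right inner_commute)
  have AQ: "A *v Q x = Q (A *v x)" for x
    by (simp add: Q_def matrix_vector_mult_diff_distrib matrix_vector_mult_scaleR A1 oA)
  have symT: "T x \<bullet> y = x \<bullet> T y" for x y
  proof -
    have "(A *v Q x) \<bullet> y = x \<bullet> (A *v Q y)"
      by (simp add: symmetric_inner_mult[OF sA] symQ AQ)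
    then show ?thesis by (simp add: T_def inner_add_left inner_add_right symQ)
  qed
  obtain k :: nat where k: "(\<Sum>i\<in>UNIV. T (axis i 1) $ i) = real k"
    using trace_projection_nat[OF linT TT symT] by blast
  have tr: "T (axis i 1) $ i = (1 - 1 / N - real d / (N * s)) / 2" for i
  proof -
    have o: "one \<bullet> axis i 1 = 1" by (simp add: inner_axis one_def)
    have "(A *v axis i 1) $ i = 0" using irr by (auto simp: A_nth axis_def irreflp_def intro!: sum.neutral)
    then have e1: "(A *v Q (axis i 1)) $ i = - real d / N"
      by (simp add: Q_def matrix_vector_mult_diff_distrib matrix_vector_mult_scaleR A1 o one_def[symmetric]) (simp add: one_def)
    have e2: "Q (axis i 1) $ i = 1 - 1 / N"
      by (simp add: Q_def o) (simp add: one_def)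
    have "T (axis i 1) $ i = (Q (axis i 1) $ i + (A *v Q (axis i 1)) $ i / s) / 2"
      by (simp add: T_def)
    then show ?thesis unfolding e1 e2 by simp
  qed
  have "real k = N * ((1 - 1 / N - real d / (N * s)) / 2)"
    unfolding k[symmetric] tr sum_constant N_def ..
  also have "\<dots> = (N - 1 - real d / s) / 2" using N0 s0 by (simp add: field_simps)
  \<comment> \<open>So \<open>real d / s\<close> is an integer \<open>z\<close> with
    \<open>d^2 = z^2 (d - 1)\<close>. As \<open>d - 1\<close> also divides \<open>d^2 - 1\<close>,
    it divides 1.\<close>
  finally have "real d / s = N - 1 - 2 * real k" by simp
  also have "\<dots> = of_int (int CARD('v) - 1 - 2 * int k)" by (simp add: N_def)
  finally obtain z :: int where "real d / s = of_int z" by blast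
  then have "real d = of_int z * s" using s0 by (simp add: field_simps)
  then have "real d * real d = of_int z * of_int z * (s * s)" by simp
  then have "real_of_int (int d * int d) = of_int (z * z * (int d - 1))" by (simp add: s2)
  then have "int d * int d = z * z * (int d - 1)" by (simp only: of_int_eq_iff)
  then have "(int d - 1) dvd int d * int d" by simp
  moreover have "int d * int d = (int d - 1) * (int d + 1) + 1" by (simp add: algebra_simps)
  ultimately have "(int d - 1) dvd 1" by (metis dvd_add_times_triv_left_iff mult.commute dvd_add_right_iff dvd_triv_left)
  then have "int d - 1 = 1" using d by (simp add: zdvd1_eq)
  then show ?thesis by simp
qed

section \<open>Collinearity classes and the resulting plane\<close>

context gap_graph
begin

definition R :: "'v \<Rightarrow> 'v \<Rightarrow> bool" where "R u v \<longleftrightarrow> u = v \<or> C u v"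

lemma R_sym: "R u v \<Longrightarrow> R v u" using C_commute by (auto simp: R_def)

lemma R_trans: "R u v \<Longrightarrow> R v w \<Longrightarrow> R u w"
  using C_trans[of v u w] C_commute by (auto simp: R_def)

text \<open>Neighbours of one vertex are related through that vertex; for distinct \<open>v\<close>
  and \<open>v'\<close> a common neighbour links the two neighbourhoods. So edges act on the classes
  of \<open>R\<close>.\<close>

lemma R_step: "R v v' \<Longrightarrow> E v w \<Longrightarrow> E v' w' \<Longrightarrow> R w w'"
proof -
  have *: "R w w'" if "E v w" "E v w'" for v w w'
    using CI[of w v w'] that E_sym by (auto simp: R_def)
  assume R: "R v v'" and E: "E v w" "E v' w'"
  show ?thesis
  proof (cases "v = v'")
    case False
    then obtain c where c: "E v c" "E v' c" using R by (auto simp: R_def collinear_in_def)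
    show ?thesis using *[OF E(1) c(1)] *[OF c(2) E(2)] by (rule R_trans)
  qed (use * E in simp)
qed

text \<open>An edge inside a class makes the class closed under edges, hence everything by
  connectedness. Any two vertices then have exactly one common neighbour, which forces
  \<open>d = 2\<close>.\<close>

lemma edge_not_R:
  assumes conn: "connected_graph E" and "E v w"
  shows "\<not> R v w"
proof
  assume vw: "R v w"
  have "R v x" if "E\<^sup>*\<^sup>* v x" for x
    using that
  proof induction
    case (step y z)
    then show ?case using R_step[of v y w z] assms(2) vw R_trans by blast
  qed (simp add: R_def)
  then have all: "R x y" for x y using conn R_sym R_trans unfolding connected_graph_def by meson
  have "card {w. E x w \<and> E y w} = 1" if "x \<noteq> y" for x y
    using g_off[OF that] all[of x y] that by (simp add: R_def gap_kernel_def)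
  then have "d = 2"
    using E_sym E_irrefl regular d_ge by (intro regular_friendship_degree[of E d]) (auto simp: symp_def irreflp_def)
  then show False using d_ge by simp
qed

text \<open>Points are the class of an arbitrary vertex \<open>u0\<close>, lines its complement,
  which is the class of a neighbour of \<open>u0\<close>. Joins and meets are the unique common
  neighbours.\<close>

lemma plane_incidence:
  assumes conn: "connected_graph E"
  shows "plane_incidence_graph (d - 1) E"
proof -
  note nR = edge_not_R[OF conn]
  fix u0 :: 'v
  obtain l1 l2 where l12: "E u0 l1" "E u0 l2" "l1 \<noteq> l2"
    using card_ge_2_obtain[of "N u0"] regular[of u0] d_ge by auto
  define P where "P = {x. R u0 x}"
  have P1: "y \<notin> P" if "x \<in> P" "E x y" for x y
    using that nR[of x y] R_sym R_trans unfolding P_def by blast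
  have two: "R u0 x \<or> R l1 x" for x
  proof -
    have "E\<^sup>*\<^sup>* u0 x" using conn by (simp add: connected_graph_def)
    then show ?thesis
    proof induction
      case (step y z)
      then show ?case using R_step[of u0 y l1 z] R_step[of l1 y u0 z] l12 E_sym by blast
    qed (simp add: R_def)
  qed
  have P2: "y \<in> P" if "x \<notin> P" "E x y" for x y
    using that two[of x] R_step[of l1 x u0 y] l12 E_sym unfolding P_def by blast
  have Rl: "R l m" if "l \<notin> P" "m \<notin> P" for l m
    using that two[of l] two[of m] R_sym R_trans unfolding P_def by blast
  have Rp: "R p q" if "p \<in> P" "q \<in> P" for p q
    using that R_sym R_trans unfolding P_def by blast
  have ax1: "\<exists>!l. l \<in> - P \<and> E p l \<and> E q l" if "p \<in> P" "q \<in> P" "p \<noteq> q" for p q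
  proof -
    have "C p q" using Rp that by (auto simp: R_def)
    then obtain l where "E p l" "E q l" by (auto simp: collinear_in_def)
    then show ?thesis using line_unique[of p q] that P1 by blast
  qed
  have ax2: "\<exists>!p. p \<in> P \<and> E p l \<and> E p m" if "l \<in> - P" "m \<in> - P" "l \<noteq> m" for l m
  proof -
    have "C l m" using Rl that by (auto simp: R_def)
    then obtain p where "E l p" "E m p" by (auto simp: collinear_in_def)
    then show ?thesis using line_unique[of l m] that P2 E_sym by blast
  qed
  have uP: "u0 \<in> P" by (simp add: P_def R_def)
  have lP: "l1 \<notin> P" "l2 \<notin> P" using P1[OF uP] l12 by auto
  have c2: "2 \<le> card (N l - {u0})" for l using regular[of l] d_ge by (auto simp: card_Diff_singleton_if)
  obtain a1 a2 where "a1 \<in> N l1 - {u0}" "a2 \<in> N l1 - {u0}" "a1 \<noteq> a2"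
    by (rule card_ge_2_obtain[OF c2[of l1]])
  then have a: "E l1 a1" "E l1 a2" "a1 \<noteq> u0" "a2 \<noteq> u0" "a1 \<noteq> a2" by auto
  obtain b1 b2 where "b1 \<in> N l2 - {u0}" "b2 \<in> N l2 - {u0}" "b1 \<noteq> b2"
    by (rule card_ge_2_obtain[OF c2[of l2]])
  then have b: "E l2 b1" "E l2 b2" "b1 \<noteq> u0" "b2 \<noteq> u0" "b1 \<noteq> b2" by auto
  have off: "x = u0" if "E l1 x" "E l2 x" for x
    using line_unique[of u0 x l1 l2] that l12 E_sym by blast
  \<comment> \<open>Two further points on each of two lines through \<open>u0\<close>;
    \<open>d \<ge> 3\<close> provides them. Three of the four include both chosen points of one line
    and a point off it.\<close>
  let ?Q = "{a1, a2, b1, b2}"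
  have QP: "?Q \<subseteq> P" using a b P2[OF lP(1)] P2[OF lP(2)] by auto
  have neab: "a1 \<noteq> b1" "a1 \<noteq> b2" "a2 \<noteq> b1" "a2 \<noteq> b2" using off a b by auto
  then have Q4: "card ?Q = 4" using a b by simp
  have Q3: "\<not> (\<exists>l\<in>- P. \<forall>p\<in>S. E p l)" if S: "S \<subseteq> ?Q" "card S = 3" for S
  proof
    assume "\<exists>l\<in>- P. \<forall>p\<in>S. E p l"
    then obtain l where l: "\<forall>p\<in>S. E p l" by auto
    have no2: "\<not> S \<subseteq> {x, y}" for x y
    proof
      assume "S \<subseteq> {x, y}"
      then have "card S \<le> card {x, y}" by (intro card_mono) auto
      also have "\<dots> \<le> 2" by (simp add: card_insert_if)
      finally show False using S(2) by simp
    qed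
    consider "a1 \<in> S" "a2 \<in> S" | "b1 \<in> S" "b2 \<in> S" | "a1 \<notin> S \<or> a2 \<notin> S" "b1 \<notin> S \<or> b2 \<notin> S" by blast
    then show False
    proof cases
      case 1
      then have "l = l1" using line_unique[of a1 a2 l l1] l a E_sym by blast
      then have "b1 \<notin> S" "b2 \<notin> S" using l off b E_sym by blast+
      then show False using no2[of a1 a2] S(1) by blast
    next
      case 2
      then have "l = l2" using line_unique[of b1 b2 l l2] l b E_sym by blast
      then have "a1 \<notin> S" "a2 \<notin> S" using l off a E_sym by blast+
      then show False using no2[of b1 b2] S(1) by blast
    next
      case 3
      then show False using no2[of a1 b1] no2[of a1 b2] no2[of a2 b1] no2[of a2 b2] S(1) by blast
    qed
  qed
  have "{p \<in> P. E p l1} = N l1" using P2[OF lP(1)] E_commute by auto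
  then have Ln: "card {p \<in> P. E p l1} = d - 1 + 1" using regular[of l1] d_ge by simp
  have "projective_plane (d - 1) P (- P) E"
    unfolding projective_plane_def
  proof (intro conjI)
    show "2 \<le> d - 1" using d_ge by simp
    show "\<exists>Q\<subseteq>P. card Q = 4 \<and> (\<forall>S\<subseteq>Q. card S = 3 \<longrightarrow> \<not> (\<exists>l\<in>- P. \<forall>p\<in>S. E p l))"
      using QP Q4 Q3 by (intro exI[of _ ?Q]) blast
    show "\<exists>l\<in>- P. card {p \<in> P. E p l} = d - 1 + 1" using Ln lP by blast
  qed (use ax1 ax2 in auto)
  moreover define f where "f v = (if v \<in> P then Inl v else Inr v)" for v
  have "bij_betw f UNIV (P <+> - P)"
    unfolding bij_betw_def inj_on_def f_def by (auto split: if_splits)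
  moreover have "\<forall>u v. E u v \<longleftrightarrow> incidence_adj E (f u) (f v)"
  proof (intro allI)
    fix u v
    show "E u v \<longleftrightarrow> incidence_adj E (f u) (f v)"
      using P1[of u v] P2[of u v] E_commute[of u v]
      by (cases "u \<in> P"; cases "v \<in> P") (auto simp: f_def)
  qed
  ultimately show ?thesis unfolding plane_incidence_graph_def by blast
qed

end

section \<open>Projective planes\<close>

locale plane =
  fixes n :: nat and P :: "'p set" and L :: "'l set" and I :: "'p \<Rightarrow> 'l \<Rightarrow> bool"
  assumes plane: "projective_plane n P L I"
begin

lemmas incidence_axioms = plane[unfolded projective_plane_def, THEN conjunct2, THEN conjunct2, THEN conjunct2]

lemmas join = incidence_axioms[THEN conjunct1, rule_format]

lemmas meet = incidence_axioms[THEN conjunct2, THEN conjunct1, rule_format]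

lemma join_unique:
  "p \<in> P \<Longrightarrow> q \<in> P \<Longrightarrow> p \<noteq> q \<Longrightarrow> l \<in> L \<Longrightarrow> m \<in> L \<Longrightarrow> I p l \<Longrightarrow> I q l \<Longrightarrow> I p m \<Longrightarrow> I q m \<Longrightarrow> l = m"
  using join[of p q] by blast

lemma quadrangle:
  obtains a b c e where "a \<in> P" "b \<in> P" "c \<in> P" "e \<in> P" "distinct [a, b, c, e]"
    "\<forall>l\<in>L. \<not> (I a l \<and> I b l \<and> I c l)" "\<forall>l\<in>L. \<not> (I a l \<and> I b l \<and> I e l)"
    "\<forall>l\<in>L. \<not> (I a l \<and> I c l \<and> I e l)" "\<forall>l\<in>L. \<not> (I b l \<and> I c l \<and> I e l)"
proof -
  obtain Q where Q: "Q \<subseteq> P" "card Q = 4"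
    and "\<forall>R\<subseteq>Q. card R = 3 \<longrightarrow> \<not> (\<exists>l\<in>L. \<forall>p\<in>R. I p l)"
    using incidence_axioms[THEN conjunct2, THEN conjunct2, THEN conjunct1] by (elim exE conjE)
  then have Q3: "\<not> (\<exists>l\<in>L. \<forall>p\<in>R. I p l)" if "R \<subseteq> Q" "card R = 3" for R using that by simp
  have "4 \<le> card Q" using Q(2) by simp
  then obtain a b c e where *: "a \<in> Q" "b \<in> Q" "c \<in> Q" "e \<in> Q" "distinct [a, b, c, e]"
    by (rule card_ge_4_obtain)
  have "\<not> (I x l \<and> I y l \<and> I z l)" if "l \<in> L" "{x, y, z} \<subseteq> Q" "distinct [x, y, z]" for x y z l
    using Q3[OF that(2)] that by auto
  then show ?thesis using * Q(1) by (intro that[of a b c e]) auto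
qed

text \<open>The perspectivity from \<open>p\<close>: joining \<open>p\<close> to the points of
  \<open>l\<close> is a bijection onto the lines through \<open>p\<close>.\<close>

lemma card_points_eq_card_lines:
  assumes p: "p \<in> P" and l: "l \<in> L" and n: "\<not> I p l"
  shows "card {m \<in> L. I p m} = card {q \<in> P. I q l}"
proof -
  have "\<forall>q\<in>{q \<in> P. I q l}. \<exists>m. m \<in> L \<and> I p m \<and> I q m"
    using join[OF p] n by (metis (mono_tags, lifting) mem_Collect_eq)
  then obtain h where h: "\<And>q. q \<in> P \<Longrightarrow> I q l \<Longrightarrow> h q \<in> L \<and> I p (h q) \<and> I q (h q)"
    by (metis (mono_tags, lifting) mem_Collect_eq)
  have "bij_betw h {q \<in> P. I q l} {m \<in> L. I p m}"
    unfolding bij_betw_def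
  proof
    show "inj_on h {q \<in> P. I q l}"
    proof (rule inj_onI, rule ccontr)
      fix x y assume *: "x \<in> {q \<in> P. I q l}" "y \<in> {q \<in> P. I q l}" "h x = h y" "x \<noteq> y"
      then have "h x = l" using join_unique[of x y "h x" l] h[of x] h[of y] l by simp
      then show False using h[of x] * n by auto
    qed
    show "h ` {q \<in> P. I q l} = {m \<in> L. I p m}"
    proof
      show "h ` {q \<in> P. I q l} \<subseteq> {m \<in> L. I p m}" using h by auto
      show "{m \<in> L. I p m} \<subseteq> h ` {q \<in> P. I q l}"
      proof
        fix m assume "m \<in> {m \<in> L. I p m}"
        then have m: "m \<in> L" "I p m" by auto
        then have "m \<noteq> l" using n by auto
        then obtain q where q: "q \<in> P" "I q m" "I q l" using meet[OF m(1) l] by blast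
        then have "p \<noteq> q" using n by auto
        then have "h q = m" using join_unique[of p q "h q" m] h[of q] p q m by simp
        then show "m \<in> h ` {q \<in> P. I q l}" using q by auto
      qed
    qed
  qed
  then show ?thesis by (metis bij_betw_same_card)
qed

text \<open>If \<open>l\<close> and \<open>m\<close> together cover a quadrangle, each contains two of its points, and the meeting
  point of the lines joining them crosswise is on neither.\<close>

lemma point_off_two_lines:
  assumes l: "l \<in> L" and m: "m \<in> L"
  obtains p where "p \<in> P" "\<not> I p l" "\<not> I p m"
proof -
  have cross: "\<exists>p\<in>P. \<not> I p l \<and> \<not> I p m"
    if P: "a \<in> P" "b \<in> P" "c \<in> P" "e \<in> P" and dist: "distinct [a, b, c, e]"
      and no: "\<And>l. l \<in> L \<Longrightarrow> \<not> (I a l \<and> I b l \<and> I c l)" "\<And>l. l \<in> L \<Longrightarrow> \<not> (I a l \<and> I b l \<and> I e l)"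
        "\<And>l. l \<in> L \<Longrightarrow> \<not> (I a l \<and> I c l \<and> I e l)" "\<And>l. l \<in> L \<Longrightarrow> \<not> (I b l \<and> I c l \<and> I e l)"
      and on: "I a l" "I b l" "I c m" "I e m" for a b c e
  proof -
    obtain u where u: "u \<in> L" "I a u" "I c u" using join[of a c] P dist by auto
    obtain v where v: "v \<in> L" "I b v" "I e v" using join[of b e] P dist by auto
    have "u \<noteq> v" using no(1)[OF u(1)] u v by auto
    then obtain x where x: "x \<in> P" "I x u" "I x v" using meet u v by blast
    have "\<not> I x l"
    proof
      assume xl: "I x l"
      have "x = a" using join_unique[of x a l u] x xl u l on P no(1)[OF l] by blast
      then show False using no(2)[OF v(1)] v x by auto
    qed
    moreover have "\<not> I x m"
    proof
      assume xm: "I x m"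
      have "x = c" using join_unique[of x c m u] x xm u m on P no(3)[OF m] by blast
      then show False using no(4)[OF v(1)] v x by auto
    qed
    ultimately show ?thesis using x by blast
  qed
  obtain a b c e where q: "a \<in> P" "b \<in> P" "c \<in> P" "e \<in> P" and dist: "distinct [a, b, c, e]"
    and no: "\<forall>l\<in>L. \<not> (I a l \<and> I b l \<and> I c l)" "\<forall>l\<in>L. \<not> (I a l \<and> I b l \<and> I e l)"
    "\<forall>l\<in>L. \<not> (I a l \<and> I c l \<and> I e l)" "\<forall>l\<in>L. \<not> (I b l \<and> I c l \<and> I e l)"
    by (rule quadrangle)
  have "\<exists>p\<in>P. \<not> I p l \<and> \<not> I p m"
  proof (rule ccontr)
    assume neg: "\<not> ?thesis"
    then have cov: "I a l \<or> I a m" "I b l \<or> I b m" "I c l \<or> I c m" "I e l \<or> I e m" using q by auto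
    note lm = no[THEN bspec, OF l] no[THEN bspec, OF m]
    consider "I a l" "I b l" "I c m" "I e m" | "I a l" "I c l" "I b m" "I e m" | "I a l" "I e l" "I b m" "I c m"
      | "I b l" "I c l" "I a m" "I e m" | "I b l" "I e l" "I a m" "I c m" | "I c l" "I e l" "I a m" "I b m"
      using cov lm by blast
    then show False
    proof cases
      case 1
      have "\<exists>p\<in>P. \<not> I p l \<and> \<not> I p m"
        by (rule cross[of a b c e]; (use dist in force | use 1 q no in blast))
      then show False using neg by blast
    next
      case 2
      have "\<exists>p\<in>P. \<not> I p l \<and> \<not> I p m"
        by (rule cross[of a c b e]; (use dist in force | use 2 q no in blast))
      then show False using neg by blast
    next
      case 3
      have "\<exists>p\<in>P. \<not> I p l \<and> \<not> I p m"
        by (rule cross[of a e b c]; (use dist in force | use 3 q no in blast))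
      then show False using neg by blast
    next
      case 4
      have "\<exists>p\<in>P. \<not> I p l \<and> \<not> I p m"
        by (rule cross[of b c a e]; (use dist in force | use 4 q no in blast))
      then show False using neg by blast
    next
      case 5
      have "\<exists>p\<in>P. \<not> I p l \<and> \<not> I p m"
        by (rule cross[of b e a c]; (use dist in force | use 5 q no in blast))
      then show False using neg by blast
    next
      case 6
      have "\<exists>p\<in>P. \<not> I p l \<and> \<not> I p m"
        by (rule cross[of c e a b]; (use dist in force | use 6 q no in blast))
      then show False using neg by blast
    qed
  qed
  then show ?thesis using that by blast
qed

text \<open>Projecting from a point off both \<open>l\<close> and the line of known size
  \<open>n + 1\<close> carries the size over.\<close>

lemma card_line: "l \<in> L \<Longrightarrow> card {q \<in> P. I q l} = n + 1"
proof -
  assume l: "l \<in> L"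
  obtain k where k: "k \<in> L" "card {p \<in> P. I p k} = n + 1"
    using incidence_axioms[THEN conjunct2, THEN conjunct2, THEN conjunct2] by (elim bexE)
  obtain p where "p \<in> P" "\<not> I p l" "\<not> I p k" by (rule point_off_two_lines[OF l k(1)])
  then show ?thesis using card_points_eq_card_lines[of p l] card_points_eq_card_lines[of p k] l k by simp
qed

text \<open>No point is on all three sides of a triangle, so \<open>p\<close> misses some line and
  its pencil is as large as that line.\<close>

lemma card_pencil: "p \<in> P \<Longrightarrow> card {m \<in> L. I p m} = n + 1"
proof -
  assume p: "p \<in> P"
  obtain a b c e where q: "a \<in> P" "b \<in> P" "c \<in> P" "e \<in> P" and dist: "distinct [a, b, c, e]"
    and no: "\<forall>l\<in>L. \<not> (I a l \<and> I b l \<and> I c l)"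
    by (rule quadrangle)
  obtain u where u: "u \<in> L" "I a u" "I b u" using join[of a b] q dist by auto
  obtain v where v: "v \<in> L" "I a v" "I c v" using join[of a c] q dist by auto
  obtain w where w: "w \<in> L" "I b w" "I c w" using join[of b c] q dist by auto
  have "\<not> (I p u \<and> I p v \<and> I p w)"
  proof
    assume *: "I p u \<and> I p v \<and> I p w"
    then have "p = a" using join_unique[of p a u v] p q u v no by blast
    then show False using * no w by blast
  qed
  then obtain l where "l \<in> L" "\<not> I p l" using u v w by blast
  then show ?thesis using card_points_eq_card_lines[OF p] card_line by simp
qed

end

section \<open>From planes back to the spectrum, and the general bound\<close>

lemma plane_incidence_codegree:
  fixes E :: "'v::finite \<Rightarrow> 'v \<Rightarrow> bool"
  assumes "plane_incidence_graph n E"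
  shows "\<exists>side :: 'v \<Rightarrow> bool. (\<forall>u. card {w. E u w} = n + 1) \<and>
    (\<forall>u v. u \<noteq> v \<longrightarrow> card {w. E u w \<and> E v w} = of_bool (side u = side v))"
proof -
  obtain P L :: "'v set" and I f where pl: "projective_plane n P L I" and f: "bij_betw f UNIV (P <+> L)"
    and E: "\<And>u v. E u v \<longleftrightarrow> incidence_adj I (f u) (f v)"
    using assms unfolding plane_incidence_graph_def by blast
  interpret plane n P L I by standard (rule pl)
  have inj: "inj f" using f by (simp add: bij_betw_def)
  have card_f: "card {w. X (f w)} = card {y \<in> P <+> L. X y}" for X
  proof -
    have "f ` {w. X (f w)} = {y \<in> range f. X y}" by auto
    also have "range f = P <+> L" using f by (simp add: bij_betw_def)
    finally have "f ` {w. X (f w)} = {y \<in> P <+> L. X y}" .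
    then show ?thesis using card_image[of f "{w. X (f w)}"] inj by (metis inj_on_subset subset_UNIV)
  qed
  have f_cases: "(\<exists>p\<in>P. f u = Inl p) \<or> (\<exists>l\<in>L. f u = Inr l)" for u
    using f unfolding bij_betw_def by (metis PlusE rangeI)
  have pt: "{y \<in> P <+> L. incidence_adj I (Inl p) y \<and> X y} = Inr ` {l \<in> L. I p l \<and> X (Inr l)}" for p X
    by (auto elim: incidence_adj.elims)
  have ln: "{y \<in> P <+> L. incidence_adj I (Inr l) y \<and> X y} = Inl ` {p \<in> P. I p l \<and> X (Inl p)}" for l X
    by (auto elim: incidence_adj.elims)
  have cInl: "card (Inl ` S) = card S" "card (Inr ` S) = card S" for S :: "'v set"
    by (auto intro!: card_image)
  have deg: "card {w. E u w} = n + 1" for u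
    using f_cases[of u] card_line card_pencil pt[where X = "\<lambda>_. True"] ln[where X = "\<lambda>_. True"]
    unfolding E card_f[of "incidence_adj I (f u)"] by (auto simp: cInl)
  \<comment> \<open>Distinguishes points from lines: equal sides share one neighbour by joining or
    meeting, opposite sides none because the graph is bipartite.\<close>
  define side where "side u = isl (f u)" for u
  have "card {w. E u w \<and> E v w} = of_bool (side u = side v)" if uv: "u \<noteq> v" for u v
  proof -
    have fuv: "f u \<noteq> f v" using inj uv by (simp add: inj_eq)
    have one: "card S = 1" if "\<exists>!x. x \<in> S" for S :: "'v set"
      using that by (auto simp: card_1_singleton_iff)
    have c: "card {w. E u w \<and> E v w} = card {y \<in> P <+> L. incidence_adj I (f u) y \<and> incidence_adj I (f v) y}"
      unfolding E by (rule card_f)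
    consider p q where "p \<in> P" "q \<in> P" "f u = Inl p" "f v = Inl q"
      | l m where "l \<in> L" "m \<in> L" "f u = Inr l" "f v = Inr m"
      | p l where "f u = Inl p" "f v = Inr l" | p l where "f u = Inr l" "f v = Inl p"
      using f_cases[of u] f_cases[of v] by blast
    then show ?thesis
    proof cases
      case 1
      then have "card {l \<in> L. I p l \<and> I q l} = 1" using join[of p q] fuv by (intro one) auto
      then show ?thesis using 1 unfolding c by (simp add: pt cInl side_def)
    next
      case 2
      then have "card {p \<in> P. I p l \<and> I p m} = 1" using meet[of l m] fuv by (intro one) auto
      then show ?thesis using 2 unfolding c by (simp add: ln cInl side_def)
    qed (unfold c, simp_all add: pt ln side_def)
  qed
  then show ?thesis using deg by (intro exI[of _ side]) simp
qed

text \<open>Here \<open>A^2 - n I\<close> consists of an all-ones block for the points and one for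
  the lines, so its quadratic form is a sum of two squares.\<close>

lemma plane_incidence_Min_ge:
  fixes E :: "'v::finite \<Rightarrow> 'v \<Rightarrow> bool"
  assumes sym: "symp E" and pl: "plane_incidence_graph n E"
  shows "sqrt (real n) \<le> Min (abs ` matrix_spectrum (adjacency_matrix E))"
proof (rule Min_abs_spectrum_ge[OF transpose_adjacency_matrix[OF sym]])
  fix x :: "real ^ 'v"
  from plane_incidence_codegree[OF pl] obtain side :: "'v \<Rightarrow> bool" where
    "(\<forall>u. card {w. E u w} = n + 1) \<and>
     (\<forall>u v. u \<noteq> v \<longrightarrow> card {w. E u w \<and> E v w} = of_bool (side u = side v))" ..
  then have deg: "\<forall>u. card {w. E u w} = n + 1"
    and cod: "\<forall>u v. u \<noteq> v \<longrightarrow> card {w. E u w \<and> E v w} = of_bool (side u = side v)"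
    by simp_all
  define f where "f = vec_nth x"
  have x: "x = vec_lambda f" by (simp add: f_def)
  have gk: "gap_kernel E (real n) u v = of_bool (side u) * of_bool (side v) + of_bool (\<not> side u) * of_bool (\<not> side v)" for u v
    using deg cod by (cases "u = v") (auto simp: gap_kernel_def)
  have "(adjacency_matrix E *v x) \<bullet> (adjacency_matrix E *v x) - real n * (x \<bullet> x)
      = (\<Sum>i\<in>UNIV. \<Sum>j\<in>UNIV. f i * f j * gap_kernel E (real n) i j)"
    unfolding x by (rule adjacency_matrix_quadratic[OF sym, symmetric])
  also have "\<dots> = (\<Sum>i\<in>UNIV. \<Sum>j\<in>UNIV. (f i * of_bool (side i)) * (f j * of_bool (side j))
      + (f i * of_bool (\<not> side i)) * (f j * of_bool (\<not> side j)))"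
    unfolding gk by (intro sum.cong refl) (simp only: algebra_simps)
  also have "\<dots> = (\<Sum>i\<in>UNIV. f i * of_bool (side i)) * (\<Sum>i\<in>UNIV. f i * of_bool (side i))
      + (\<Sum>i\<in>UNIV. f i * of_bool (\<not> side i)) * (\<Sum>i\<in>UNIV. f i * of_bool (\<not> side i))"
    by (simp only: sum.distrib sum_product)
  also have "\<dots> \<ge> 0" by simp
  finally show "(sqrt (real n))\<^sup>2 * (x \<bullet> x) \<le> (adjacency_matrix E *v x) \<bullet> (adjacency_matrix E *v x)" by simp
qed

text \<open>Otherwise \<open>A^2 - (d - 1) I\<close> is positive definite with integer diagonal
  entries at most 1, hence equal to 1. Two neighbours of one vertex then have an entry of at least
  1, against strict Cauchy-Schwarz.\<close>

lemma Min_abs_spectrum_le_sqrt: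
  fixes E :: "'v::finite \<Rightarrow> 'v \<Rightarrow> bool"
  assumes sym: "symp E" and d: "2 \<le> d" and deg: "\<And>v. card {w. E v w} \<le> d"
  shows "Min (abs ` matrix_spectrum (adjacency_matrix E)) \<le> sqrt (real d - 1)"
proof (rule ccontr)
  let ?g = "gap_kernel E (real d - 1)"
  assume "\<not> ?thesis"
  then have pd: "pd_on UNIV ?g" using d by (intro pd_gap_kernel[OF sym]) auto
  have diag: "?g v v = 1" for v
    using pd_on_diag[OF pd, of v] deg[of v] by (simp add: gap_kernel_def)
  fix v :: 'v
  have "2 \<le> card {w. E v w}" using diag[of v] d by (simp add: gap_kernel_def)
  then obtain a b where ab: "E v a" "E v b" "a \<noteq> b" using card_ge_2_obtain by (metis mem_Collect_eq)
  have "v \<in> {w. E a w \<and> E b w}" using ab sym by (auto dest: sympD)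
  then have "card {w. E a w \<and> E b w} \<noteq> 0" by (metis card_0_eq emptyE finite)
  then have "1 \<le> card {w. E a w \<and> E b w}" by linarith
  then have "1 \<le> ?g a b" using ab by (simp add: gap_kernel_def)
  then have "1 \<le> (?g a b)\<^sup>2" by simp
  then show False using pd_on_minor[OF pd, of a b] ab diag by simp
qed

theorem theorem1p1:
  fixes d :: nat and E :: "'v::finite \<Rightarrow> 'v \<Rightarrow> bool"
  assumes "d \<ge> 3"
    and "simple_graph E" and "connected_graph E"
    and "CARD('v) \<ge> 3"
    and "max_degree E \<le> d"
  shows "Min (abs ` matrix_spectrum (adjacency_matrix E)) \<le> sqrt (real d - 1) \<and>
    (Min (abs ` matrix_spectrum (adjacency_matrix E)) = sqrt (real d - 1)
       \<longleftrightarrow> plane_incidence_graph (d - 1) E) \<and>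
    ((\<nexists>n. plane_incidence_graph n E) \<longrightarrow>
       Min (abs ` matrix_spectrum (adjacency_matrix E)) \<le> sqrt (real d - 2))"
proof -
  let ?m = "Min (abs ` matrix_spectrum (adjacency_matrix E))"
  have sym: "symp E" and irr: "irreflp E" using assms(2) by (auto simp: simple_graph_def)
  have deg: "card {w. E v w} \<le> d" for v
    using Max_ge[of "range (vertex_degree E)" "vertex_degree E v"] assms(5)
    by (simp add: max_degree_def vertex_degree_def)
  have le: "?m \<le> sqrt (real d - 1)"
    using assms(1) deg by (intro Min_abs_spectrum_le_sqrt[OF sym]) auto
  \<comment> \<open>Any minimum above \<open>sqrt (real d - 2)\<close> already forces a plane. This
    yields one direction of the equality case and, by contraposition, the last claim.\<close>
  have plane: "plane_incidence_graph (d - 1) E" if lt: "sqrt (real d - 2) < ?m"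
  proof -
    have "pd_on UNIV (gap_kernel E (real d - 2))"
      using lt assms(1) by (intro pd_gap_kernel[OF sym]) auto
    then interpret gap_graph E d
      using sym irr assms(1) deg by unfold_locales (auto dest: sympD irreflpD)
    show ?thesis by (rule plane_incidence[OF assms(3)])
  qed
  have ge: "sqrt (real d - 1) \<le> ?m" if "plane_incidence_graph (d - 1) E"
    using plane_incidence_Min_ge[OF sym that] assms(1) by (simp add: of_nat_diff)
  have "sqrt (real d - 2) < sqrt (real d - 1)" by simp
  then have "?m = sqrt (real d - 1) \<longleftrightarrow> plane_incidence_graph (d - 1) E"
    using plane ge le by (metis order_antisym)
  moreover have "?m \<le> sqrt (real d - 2)" if "\<nexists>n. plane_incidence_graph n E"
    using plane that by (meson not_less)
  ultimately show ?thesis using le by blast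
qed

end
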